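(* Let $g_0$ be the canonical metric on the unit sphere $S^{2m+1}$. For all Riemannian $g_0$-natural metrics $G$ on $TS^{2m+1}$ satisfying $\alpha_2(1)=\beta_2(1)=0$, a Hopf vector field $\bar\xi$ defines a harmonic map $\bar\xi:(S^{2m+1},g_0)\to(TS^{2m+1},G)$ if and only if $$2m(\alpha_1+\alpha_1')(1)+[2m(\alpha_1+\alpha_3)+\phi_1+\phi_3]'(1)=0.$$
   Context: Hopf vector fields on the unit sphere $S^{2m+1}$ with its canonical metric $g_0$ are exactly the Killing unit vector fields on $(S^{2m+1},g_0)$. Let $(M,g)$ be an $n$-dimensional Riemannian manifold with Levi-Civita connection $\nabla$. For $x\in M$ and $u,X\in T_xM$, $X^h$ and $X^v$ denote the horizontal (with respect to $\nabla$) and vertical lifts of $X$ to $(x,u)\in TM$. A $g$-natural metric $G$ on $TM$ is determined by six smooth functions $\alpha_i,\beta_i:\mathbb R^+=[0,\infty)\to\mathbb R$, $i=1,2,3$ (with $\beta_i=0$ if $n=1$): with $r^2=g(u,u)$, $G_{(x,u)}(X^h,Y^h)=(\alpha_1+\alpha_3)(r^2)g(X,Y)+(\beta_1+\beta_3)(r^2)g(X,u)g(Y,u)$, $G_{(x,u)}(X^h,Y^v)=G_{(x,u)}(X^v,Y^h)=\alpha_2(r^2)g(X,Y)+\beta_2(r^2)g(X,u)g(Y,u)$, $G_{(x,u)}(X^v,Y^v)=\alpha_1(r^2)g(X,Y)+\beta_1(r^2)g(X,u)g(Y,u)$. Put $\phi_i(t)=\alpha_i(t)+t\beta_i(t)$,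 $\alpha=\alpha_1(\alpha_1+\alpha_3)-\alpha_2^2$, $\phi=\phi_1(\phi_1+\phi_3)-\phi_2^2$. $G$ is Riemannian iff $\alpha_1,\phi_1,\alpha,\phi>0$ on $\mathbb R^+$. A vector field $V$, regarded as a map $V:(M,g)\to(TM,G)$, defines a harmonic map iff its tension field $\tau(V)=\mathrm{tr}(\nabla dV)$ vanishes. *)

theory Defs
  imports "HOL-Analysis.Analysis"
begin

section \<open>Smooth functions\<close>

text \<open>
  \<open>dd f y v\<close> is the derivative of \<open>f\<close> at \<open>y\<close> in direction \<open>v\<close>.
\<close>

abbreviation dd :: "('a::real_normed_vector \<Rightarrow> 'b::real_normed_vector) \<Rightarrow> 'a \<Rightarrow> 'a \<Rightarrow> 'b" where
  "dd f y v \<equiv> frechet_derivative f (at y) v"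

text \<open>Only meant for open \<open>U\<close>.\<close>

primrec Ck_on :: "nat \<Rightarrow> 'a::euclidean_space set \<Rightarrow> ('a \<Rightarrow> 'b::real_normed_vector) \<Rightarrow> bool" where
  "Ck_on 0 U f \<longleftrightarrow> continuous_on U f"
| "Ck_on (Suc k) U f \<longleftrightarrow> f differentiable_on U \<and> (\<forall>v. Ck_on k U (\<lambda>y. dd f y v))"

definition smooth_on :: "'a::euclidean_space set \<Rightarrow> ('a \<Rightarrow> 'b::real_normed_vector) \<Rightarrow> bool" where
  "smooth_on U f \<longleftrightarrow> (\<forall>k. Ck_on k U f)"

text \<open>Smoothness on the closed half line, with one-sided derivatives at the end point.\<close>

definition smooth_halfline :: "(real \<Rightarrow> real) \<Rightarrow> bool" where
  "smooth_halfline f \<longleftrightarrow>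
     (\<exists>F :: nat \<Rightarrow> real \<Rightarrow> real.
        (\<forall>t\<ge>0. F 0 t = f t) \<and>
        (\<forall>k. \<forall>t\<ge>0. (F k has_real_derivative F (Suc k) t) (at t within {0..})))"

section \<open>Embedded manifolds, tangent bundle, Riemannian metrics\<close>

text \<open>
  Manifolds are embedded submanifolds \<open>M\<close> of a Euclidean space \<open>'a\<close>, described by all their
  smooth local parametrizations \<open>\<phi>\<close>, defined on open sets of a model space \<open>'c\<close> with
  \<open>DIM('c) = dim M\<close>. Where the model space does not occur in the type of the other arguments,
  it is passed as \<open>TYPE('c)\<close>. The letters \<open>y\<close>, \<open>z\<close> denote points of the model space.
\<close>

definition local_param ::
  "'a::euclidean_space set \<Rightarrow> 'c::euclidean_space set \<Rightarrow> ('c \<Rightarrow> 'a) \<Rightarrow> bool" where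
  "local_param M U \<phi> \<longleftrightarrow>
     open U \<and> smooth_on U \<phi> \<and> \<phi> ` U \<subseteq> M \<and> openin (top_of_set M) (\<phi> ` U) \<and>
     inj_on \<phi> U \<and> continuous_on (\<phi> ` U) (inv_into U \<phi>) \<and>
     (\<forall>y\<in>U. inj (dd \<phi> y))"

definition tangent_space :: "'a::euclidean_space set \<Rightarrow> 'a \<Rightarrow> 'a set" where
  "tangent_space M x =
     {X. \<exists>c :: real \<Rightarrow> 'a. c 0 = x \<and> (\<forall>\<^sub>F t in at 0. c t \<in> M) \<and>
           (c has_vector_derivative X) (at 0)}"

definition tangent_bundle :: "'a::euclidean_space set \<Rightarrow> ('a \<times> 'a) set" where
  "tangent_bundle M = {(x, u). x \<in> M \<and> u \<in> tangent_space M x}"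

definition smooth_map ::
  "'c::euclidean_space itself \<Rightarrow> 'a::euclidean_space set \<Rightarrow> ('a \<Rightarrow> 'b::euclidean_space) \<Rightarrow> bool" where
  "smooth_map _ M f \<longleftrightarrow>
     (\<forall>(U :: 'c set) \<phi>. local_param M U \<phi> \<longrightarrow> smooth_on U (\<lambda>y. f (\<phi> y)))"

text \<open>A metric \<open>g\<close> on \<open>M\<close> in the coordinates \<open>\<phi>\<close>, as a field of bilinear forms on the model space.\<close>

definition coord_metric ::
  "('a::euclidean_space \<Rightarrow> 'a \<Rightarrow> 'a \<Rightarrow> real) \<Rightarrow> ('c::euclidean_space \<Rightarrow> 'a) \<Rightarrow> 'c \<Rightarrow> 'c \<Rightarrow> 'c \<Rightarrow> real" where
  "coord_metric g \<phi> y v w = g (\<phi> y) (dd \<phi> y v) (dd \<phi> y w)"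

text \<open>The values of \<open>g x\<close> outside of the tangent space at \<open>x\<close> are irrelevant.\<close>

definition riemannian_metric ::
  "'c::euclidean_space itself \<Rightarrow> 'a::euclidean_space set \<Rightarrow> ('a \<Rightarrow> 'a \<Rightarrow> 'a \<Rightarrow> real) \<Rightarrow> bool" where
  "riemannian_metric _ M g \<longleftrightarrow>
     (\<forall>x\<in>M. \<forall>X\<in>tangent_space M x. \<forall>Y\<in>tangent_space M x. \<forall>Z\<in>tangent_space M x. \<forall>a b.
        g x (a *\<^sub>R X + b *\<^sub>R Y) Z = a * g x X Z + b * g x Y Z) \<and>
     (\<forall>x\<in>M. \<forall>X\<in>tangent_space M x. \<forall>Y\<in>tangent_space M x. g x X Y = g x Y X) \<and>
     (\<forall>x\<in>M. \<forall>X\<in>tangent_space M x. X \<noteq> 0 \<longrightarrow> g x X X > 0) \<and>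
     (\<forall>(U :: 'c set) \<phi> v w. local_param M U \<phi> \<longrightarrow> smooth_on U (\<lambda>y. coord_metric g \<phi> y v w))"

definition canonical_metric :: "'a::euclidean_space \<Rightarrow> 'a \<Rightarrow> 'a \<Rightarrow> real" where
  "canonical_metric x X Y = X \<bullet> Y"

text \<open>
  \<open>christoffel h y v w\<close> is the vector with components \<open>\<Gamma>\<^sup>k\<^sub>i\<^sub>j v\<^sup>i w\<^sup>j\<close> of the Levi-Civita connection of
  the field of bilinear forms \<open>h\<close>, characterized by the Koszul formula for constant
  (hence commuting) fields.
\<close>

definition christoffel ::
  "('c::euclidean_space \<Rightarrow> 'c \<Rightarrow> 'c \<Rightarrow> real) \<Rightarrow> 'c \<Rightarrow> 'c \<Rightarrow> 'c \<Rightarrow> 'c" where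
  "christoffel h y v w =
     (THE z. \<forall>u. 2 * h y z u =
        dd (\<lambda>y. h y w u) y v + dd (\<lambda>y. h y v u) y w - dd (\<lambda>y. h y v w) y u)"

section \<open>Harmonic maps\<close>

text \<open>
  For a map \<open>F\<close> between open subsets of model spaces with metrics \<open>g\<close>, \<open>h\<close>, this is
  \<open>(\<nabla>dF)(v, w) = D\<^sup>2F(v, w) - dF(\<Gamma>\<^sup>g(v, w)) + \<Gamma>\<^sup>h(dF v, dF w)\<close>.
\<close>

definition nabla_d ::
  "('c::euclidean_space \<Rightarrow> 'c \<Rightarrow> 'c \<Rightarrow> real) \<Rightarrow> ('d::euclidean_space \<Rightarrow> 'd \<Rightarrow> 'd \<Rightarrow> real) \<Rightarrow>
   ('c \<Rightarrow> 'd) \<Rightarrow> 'c \<Rightarrow> 'c \<Rightarrow> 'c \<Rightarrow> 'd" where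
  "nabla_d g h F y v w =
     dd (\<lambda>z. dd F z w) y v - dd F y (christoffel g y v w) +
     christoffel h (F y) (dd F y v) (dd F y w)"

text \<open>\<open>sharp b e\<^sub>i\<close> is \<open>\<Sum>\<^sub>j b\<^sup>i\<^sup>j e\<^sub>j\<close>, so \<open>metric_trace b B\<close> is \<open>\<Sum>\<^sub>i\<^sub>j b\<^sup>i\<^sup>j B\<^sub>i\<^sub>j\<close>.\<close>

definition sharp :: "('c::euclidean_space \<Rightarrow> 'c \<Rightarrow> real) \<Rightarrow> 'c \<Rightarrow> 'c" where
  "sharp b e = (THE z. \<forall>w. b z w = e \<bullet> w)"

definition metric_trace ::
  "('c::euclidean_space \<Rightarrow> 'c \<Rightarrow> real) \<Rightarrow> ('c \<Rightarrow> 'c \<Rightarrow> 'd::real_vector) \<Rightarrow> 'd" where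
  "metric_trace b B = (\<Sum>e\<in>Basis. B e (sharp b e))"

definition tension ::
  "('c::euclidean_space \<Rightarrow> 'c \<Rightarrow> 'c \<Rightarrow> real) \<Rightarrow> ('d::euclidean_space \<Rightarrow> 'd \<Rightarrow> 'd \<Rightarrow> real) \<Rightarrow>
   ('c \<Rightarrow> 'd) \<Rightarrow> 'c \<Rightarrow> 'd" where
  "tension g h F y = metric_trace (g y) (nabla_d g h F y)"

text \<open>The tension field vanishes iff its coordinate expressions do.\<close>

definition harmonic_map ::
  "'c::euclidean_space itself \<Rightarrow> 'd::euclidean_space itself \<Rightarrow>
   'a::euclidean_space set \<Rightarrow> ('a \<Rightarrow> 'a \<Rightarrow> 'a \<Rightarrow> real) \<Rightarrow>
   'b::euclidean_space set \<Rightarrow> ('b \<Rightarrow> 'b \<Rightarrow> 'b \<Rightarrow> real) \<Rightarrow> ('a \<Rightarrow> 'b) \<Rightarrow> bool" where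
  "harmonic_map _ _ M g N h f \<longleftrightarrow>
     f ` M \<subseteq> N \<and> smooth_map TYPE('c) M f \<and>
     (\<forall>(U :: 'c set) \<phi> (W :: 'd set) \<psi>.
        local_param M U \<phi> \<longrightarrow> local_param N W \<psi> \<longrightarrow>
        (\<forall>y\<in>U. f (\<phi> y) \<in> \<psi> ` W \<longrightarrow>
           tension (coord_metric g \<phi>) (coord_metric h \<psi>) (\<lambda>z. inv_into W \<psi> (f (\<phi> z))) y = 0))"

section \<open>Hopf vector fields\<close>

definition vector_field ::
  "'c::euclidean_space itself \<Rightarrow> 'a::euclidean_space set \<Rightarrow> ('a \<Rightarrow> 'a) \<Rightarrow> bool" where
  "vector_field _ M V \<longleftrightarrow> (\<forall>x\<in>M. V x \<in> tangent_space M x) \<and> smooth_map TYPE('c) M V"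

definition coord_field ::
  "('a::euclidean_space \<Rightarrow> 'a) \<Rightarrow> ('c::euclidean_space \<Rightarrow> 'a) \<Rightarrow> 'c \<Rightarrow> 'c" where
  "coord_field V \<phi> y = (THE v. dd \<phi> y v = V (\<phi> y))"

text \<open>\<open>(L\<^sub>V g)\<^sub>i\<^sub>j = V\<^sup>k \<partial>\<^sub>k g\<^sub>i\<^sub>j + g\<^sub>k\<^sub>j \<partial>\<^sub>i V\<^sup>k + g\<^sub>i\<^sub>k \<partial>\<^sub>j V\<^sup>k\<close>\<close>

definition lie_metric ::
  "('c::euclidean_space \<Rightarrow> 'c) \<Rightarrow> ('c \<Rightarrow> 'c \<Rightarrow> 'c \<Rightarrow> real) \<Rightarrow> 'c \<Rightarrow> 'c \<Rightarrow> 'c \<Rightarrow> real" where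
  "lie_metric V g y v w =
     dd (\<lambda>z. g z v w) y (V y) + g y (dd V y v) w + g y v (dd V y w)"

definition killing_field ::
  "'c::euclidean_space itself \<Rightarrow> 'a::euclidean_space set \<Rightarrow> ('a \<Rightarrow> 'a \<Rightarrow> 'a \<Rightarrow> real) \<Rightarrow>
   ('a \<Rightarrow> 'a) \<Rightarrow> bool" where
  "killing_field _ M g V \<longleftrightarrow>
     vector_field TYPE('c) M V \<and>
     (\<forall>(U :: 'c set) \<phi>. local_param M U \<phi> \<longrightarrow>
        (\<forall>y\<in>U. \<forall>v w. lie_metric (coord_field V \<phi>) (coord_metric g \<phi>) y v w = 0))"

text \<open>Hopf vector fields on an odd-dimensional unit sphere: the Killing unit vector fields.\<close>

definition hopf_field ::
  "'c::euclidean_space itself \<Rightarrow> ('a::euclidean_space \<Rightarrow> 'a) \<Rightarrow> bool" where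
  "hopf_field _ V \<longleftrightarrow>
     killing_field TYPE('c) (sphere 0 1) canonical_metric V \<and>
     (\<forall>x\<in>sphere 0 1. canonical_metric x (V x) (V x) = 1)"

section \<open>Natural metrics on the tangent bundle\<close>

definition tangent_param ::
  "('c::euclidean_space \<Rightarrow> 'a::euclidean_space) \<Rightarrow> 'c \<times> 'c \<Rightarrow> 'a \<times> 'a" where
  "tangent_param \<phi> = (\<lambda>(y, v). (\<phi> y, dd \<phi> y v))"

text \<open>
  \<open>Z\<close> is the horizontal lift \<open>X\<^sup>i \<partial>/\<partial>x\<^sup>i - \<Gamma>\<^sup>k\<^sub>i\<^sub>j X\<^sup>i u\<^sup>j \<partial>/\<partial>u\<^sup>k\<close> of \<open>X\<close> to \<open>(x, u)\<close>;
  here \<open>v\<close> and \<open>w\<close> are the coordinates of \<open>u\<close> and \<open>X\<close>.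
\<close>

definition horizontal_lift ::
  "'c::euclidean_space itself \<Rightarrow> 'a::euclidean_space set \<Rightarrow> ('a \<Rightarrow> 'a \<Rightarrow> 'a \<Rightarrow> real) \<Rightarrow>
   'a \<Rightarrow> 'a \<Rightarrow> 'a \<Rightarrow> 'a \<times> 'a \<Rightarrow> bool" where
  "horizontal_lift _ M g x u X Z \<longleftrightarrow>
     (\<exists>(U :: 'c set) \<phi> y v w. local_param M U \<phi> \<and> y \<in> U \<and>
        x = \<phi> y \<and> u = dd \<phi> y v \<and> X = dd \<phi> y w \<and>
        Z = dd (tangent_param \<phi>) (y, v) (w, - christoffel (coord_metric g \<phi>) y w v))"

text \<open>The velocity at \<open>t = 0\<close> of the curve \<open>t \<mapsto> (x, u + t X)\<close>.\<close>

definition vertical_lift :: "'a::euclidean_space \<Rightarrow> 'a \<times> 'a" where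
  "vertical_lift X = (0, X)"

text \<open>
  \<open>\<alpha> i\<close> and \<open>\<beta> i\<close> are used for \<open>i = 1, 2, 3\<close> only. The predicate describes a \<open>g\<close>-natural metric
  that need not be positive definite; bilinearity is part of \<^const>\<open>riemannian_metric\<close>.
\<close>

definition natural_metric ::
  "'c::euclidean_space itself \<Rightarrow> 'a::euclidean_space set \<Rightarrow> ('a \<Rightarrow> 'a \<Rightarrow> 'a \<Rightarrow> real) \<Rightarrow>
   (nat \<Rightarrow> real \<Rightarrow> real) \<Rightarrow> (nat \<Rightarrow> real \<Rightarrow> real) \<Rightarrow>
   ('a \<times> 'a \<Rightarrow> 'a \<times> 'a \<Rightarrow> 'a \<times> 'a \<Rightarrow> real) \<Rightarrow> bool" where
  "natural_metric _ M g \<alpha> \<beta> G \<longleftrightarrow>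
     (\<forall>i\<in>{1, 2, 3}. smooth_halfline (\<alpha> i) \<and> smooth_halfline (\<beta> i)) \<and>
     (DIM('c) = 1 \<longrightarrow> (\<forall>i\<in>{1, 2, 3}. \<forall>t\<ge>0. \<beta> i t = 0)) \<and>
     (\<forall>x\<in>M. \<forall>u\<in>tangent_space M x. \<forall>X\<in>tangent_space M x. \<forall>Y\<in>tangent_space M x. \<forall>Xh Yh.
        horizontal_lift TYPE('c) M g x u X Xh \<longrightarrow> horizontal_lift TYPE('c) M g x u Y Yh \<longrightarrow>
        (let r2 = g x u u; Xv = vertical_lift X; Yv = vertical_lift Y in
           G (x, u) Xh Yh = (\<alpha> 1 r2 + \<alpha> 3 r2) * g x X Y + (\<beta> 1 r2 + \<beta> 3 r2) * g x X u * g x Y u \<and>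
           G (x, u) Xh Yv = \<alpha> 2 r2 * g x X Y + \<beta> 2 r2 * g x X u * g x Y u \<and>
           G (x, u) Xv Yh = \<alpha> 2 r2 * g x X Y + \<beta> 2 r2 * g x X u * g x Y u \<and>
           G (x, u) Xv Yv = \<alpha> 1 r2 * g x X Y + \<beta> 1 r2 * g x X u * g x Y u))"

definition phi :: "(nat \<Rightarrow> real \<Rightarrow> real) \<Rightarrow> (nat \<Rightarrow> real \<Rightarrow> real) \<Rightarrow> nat \<Rightarrow> real \<Rightarrow> real" where
  "phi \<alpha> \<beta> i t = \<alpha> i t + t * \<beta> i t"

end

theory Submission imports Defs begin

text \<open>
  Why the theorem is true. A unit Killing field on the sphere is the restriction of a skew linear
  isometry \<open>J\<close> of the ambient Euclidean space: by Clairaut's relation \<open>\<xi> \<bullet> \<gamma>'\<close> is constant along every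
  great circle \<open>\<gamma>\<close>, which gives \<open>\<xi> x \<bullet> y + x \<bullet> \<xi> y = 0\<close> for all points \<open>x\<close>, \<open>y\<close> of the sphere
  (\<open>killing_skew\<close>), and such a map is linear (\<open>hopf_field_linear\<close>). Hence the section
  \<open>x \<mapsto> (x, \<xi> x)\<close> is the restriction of the linear map \<open>x \<mapsto> (x, J x)\<close>, and its second derivatives in
  a chart \<open>\<phi>\<close> of the sphere are those of \<open>\<phi>\<close> itself.

  The horizontal lift of \<open>X\<close> to \<open>(x, u)\<close> is \<open>(X, - (X \<bullet> u) x)\<close>, so that on tangent vectors of the
  tangent bundle the natural metric agrees with a form that is given by an explicit formula on the whole
  ambient space and depends on \<open>(x, u)\<close> through \<open>u\<close> alone (\<open>natural_form\<close>,
  \<open>natural_metric_eq_form\<close>). For a metric that is pulled back from an ambient family of bilinear forms \<open>H\<close>,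
  the Koszul formula expresses the Christoffel symbols through the ambient derivative of \<open>H\<close>
  and the second derivative of the parametrization (\<open>christoffel_pullback\<close>). In \<open>\<nabla>df\<close> the second
  derivatives of the parametrization \<open>\<psi>\<close> of the target then combine with those of \<open>\<psi>\<^sup>-\<^sup>1 \<circ> f \<circ> \<phi>\<close> to the
  second derivatives of \<open>f \<circ> \<phi>\<close>, and no coordinates of the target remain (\<open>nabla_d_formula\<close>).

  For the sphere \<open>D\<^sup>2\<phi>(v, w) - d\<phi>(\<Gamma>(v, w)) = - (d\<phi> v \<bullet> d\<phi> w) \<phi>\<close>, because the left hand side is
  normal. Inserting everything and taking the trace over the tangent space of the sphere, the terms in
  \<open>\<alpha>\<^sub>2\<close>, \<open>\<beta>\<^sub>2\<close> and their derivatives cancel by skewness of \<open>J\<close>, and for every tangent vector \<open>C = (Y, k)\<close>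
  at \<open>(x, J x)\<close> the result is \<open>G(\<tau>, C) = - (J x \<bullet> k) E\<close> (\<open>hopf_tension\<close>), where \<open>E\<close> is the left hand
  side of the equation in the theorem. If \<open>E = 0\<close>, then \<open>\<tau>\<close> is orthogonal to
  itself and vanishes; if \<open>\<tau> = 0\<close> at a single point, then the vertical vector \<open>C = (0, J x)\<close> gives \<open>E = 0\<close>.

  A local parametrization of the target is only assumed to have a continuous inverse. The differentiability
  of \<open>\<psi>\<^sup>-\<^sup>1 \<circ> f \<circ> \<phi>\<close>, to second order, is obtained by implicit differentiation of \<open>\<psi> \<circ> F = f \<circ> \<phi>\<close>
  (\<open>has_derivative_implicit\<close>). Charts of the sphere and of its tangent bundle are supplied by
  stereographic projection and its differential (\<open>sphere_chart\<close>, \<open>tangent_param_local_param\<close>).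
\<close>

section \<open>Second derivatives and implicit differentiation\<close>

lemma dd_eq: "(f has_derivative f') (at y) \<Longrightarrow> dd f y v = f' v"
  using frechet_derivative_at by metis

lemma dd_works: "f differentiable at y \<Longrightarrow> (f has_derivative dd f y) (at y)"
  using frechet_derivative_works by blast

text \<open>
  The second difference \<open>f (y + tv + tw) - f (y + tv) - f (y + tw) + f y\<close> is
  \<open>t\<^sup>2 D\<^sub>w D\<^sub>v f + o(t\<^sup>2)\<close>: the mean value theorem along \<open>v\<close> turns it into a first difference of \<open>D\<^sub>v f\<close>
  in direction \<open>w\<close>, so that differentiability of \<open>D\<^sub>v f\<close> at the single point \<open>y\<close> suffices.
\<close>

lemma second_difference_quotient:
  fixes f :: "'a::real_normed_vector \<Rightarrow> real"
  assumes "open U" "y \<in> U"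
    and diff: "\<And>z. z \<in> U \<Longrightarrow> f differentiable at z"
    and D: "((\<lambda>z. dd f z v) has_derivative D) (at y)"
    and "\<epsilon> > 0"
  obtains \<delta> where "\<delta> > 0"
    "\<And>t. 0 < t \<Longrightarrow> t < \<delta> \<Longrightarrow>
       \<bar>(f (y + t *\<^sub>R v + t *\<^sub>R w) - f (y + t *\<^sub>R v) - f (y + t *\<^sub>R w) + f y) - t\<^sup>2 * D w\<bar> \<le> \<epsilon> * t\<^sup>2"
proof -
  interpret D: bounded_linear D using D by (rule has_derivative_bounded_linear)
  \<comment> \<open>All points in question are within \<open>t N\<close> of \<open>y\<close>; the two error terms add up to at most \<open>e t N = \<epsilon> t\<close>.\<close>
  define N where "N = 2 * (norm v + norm w) + 1"
  have N: "N > 0" by (simp add: N_def add_nonneg_pos)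
  define e where "e = \<epsilon> / N"
  have e: "e > 0" using \<open>\<epsilon> > 0\<close> N by (simp add: e_def)
  obtain d1 where d1: "d1 > 0" "ball y d1 \<subseteq> U" using \<open>open U\<close> \<open>y \<in> U\<close> open_contains_ball by blast
  obtain d2 where d2: "d2 > 0"
    "\<And>z. norm (z - y) < d2 \<Longrightarrow> norm (dd f z v - dd f y v - D (z - y)) \<le> e * norm (z - y)"
    using D e unfolding has_derivative_at_alt by blast
  define \<delta> where "\<delta> = min d1 d2 / N"
  have "\<delta> > 0" using d1 d2 N by (simp add: \<delta>_def)
  moreover have "\<bar>(f (y + t *\<^sub>R v + t *\<^sub>R w) - f (y + t *\<^sub>R v) - f (y + t *\<^sub>R w) + f y) - t\<^sup>2 * D w\<bar> \<le> \<epsilon> * t\<^sup>2"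
    if t: "0 < t" "t < \<delta>" for t
  proof -
    have near: "norm (s *\<^sub>R v + r *\<^sub>R w) \<le> t * (norm v + norm w)" if "0 \<le> s" "s \<le> t" "0 \<le> r" "r \<le> t" for s r
    proof -
      have "norm (s *\<^sub>R v + r *\<^sub>R w) \<le> s * norm v + r * norm w"
        using that by (metis abs_of_nonneg norm_scaleR norm_triangle_ineq)
      also have "\<dots> \<le> t * norm v + t * norm w"
        using that by (intro add_mono mult_right_mono) auto
      finally show ?thesis by (simp add: algebra_simps)
    qed
    have "t * N < min d1 d2" using t N by (simp add: \<delta>_def pos_less_divide_eq)
    moreover have "t * (norm v + norm w) \<le> t * N"
      using t N by (intro mult_left_mono) (auto simp: N_def)
    ultimately have small: "t * (norm v + norm w) < d1" "t * (norm v + norm w) < d2" by auto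
    have inU: "y + s *\<^sub>R v + r *\<^sub>R w \<in> U" if "0 \<le> s" "s \<le> t" "0 \<le> r" "r \<le> t" for s r
    proof -
      have "dist y (y + s *\<^sub>R v + r *\<^sub>R w) = norm (s *\<^sub>R v + r *\<^sub>R w)"
        by (metis add.assoc add_diff_cancel_left' dist_commute dist_norm)
      then show ?thesis using near[OF that] small d1(2) by auto
    qed
    define g where "g s = f (y + s *\<^sub>R v + t *\<^sub>R w) - f (y + s *\<^sub>R v)" for s
    have g': "(g has_real_derivative (dd f (y + s *\<^sub>R v + t *\<^sub>R w) v - dd f (y + s *\<^sub>R v) v)) (at s)"
      if s: "0 \<le> s" "s \<le> t" for s
    proof -
      have 1: "f differentiable at (y + s *\<^sub>R v + t *\<^sub>R w)" "f differentiable at (y + s *\<^sub>R v)"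
        using diff[OF inU[of s t]] diff[OF inU[of s 0]] s t by auto
      have "(g has_derivative (\<lambda>h. dd f (y + s *\<^sub>R v + t *\<^sub>R w) (h *\<^sub>R v) - dd f (y + s *\<^sub>R v) (h *\<^sub>R v))) (at s)"
        unfolding g_def
        by (intro has_derivative_diff has_derivative_compose[where f="\<lambda>s. y + s *\<^sub>R v + t *\<^sub>R w", OF _ dd_works[OF 1(1)]]
             has_derivative_compose[where f="\<lambda>s. y + s *\<^sub>R v", OF _ dd_works[OF 1(2)]])
           (auto intro!: derivative_eq_intros)
      moreover have "dd f z (h *\<^sub>R v) = h * dd f z v" if "f differentiable at z" for z h
        using linear_scale[OF linear_frechet_derivative[OF that]] by simp
      moreover have "(\<lambda>h. dd f (y + s *\<^sub>R v + t *\<^sub>R w) (h *\<^sub>R v) - dd f (y + s *\<^sub>R v) (h *\<^sub>R v))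
          = (*) (dd f (y + s *\<^sub>R v + t *\<^sub>R w) v - dd f (y + s *\<^sub>R v) v)"
        by (simp add: calculation(2)[OF 1(1)] calculation(2)[OF 1(2)] right_diff_distrib fun_eq_iff mult.commute)
      ultimately show ?thesis by (simp add: has_field_derivative_def)
    qed
    obtain s where s: "0 < s" "s < t"
      and gs: "g t - g 0 = (t - 0) * (dd f (y + s *\<^sub>R v + t *\<^sub>R w) v - dd f (y + s *\<^sub>R v) v)"
      using MVT2[OF t(1) g'] by metis
    define p q where "p = s *\<^sub>R v + t *\<^sub>R w" and "q = s *\<^sub>R v"
    have np: "norm p \<le> t * (norm v + norm w)" "norm q \<le> t * (norm v + norm w)"
      using near[of s t] near[of s 0] s t by (auto simp: p_def q_def)
    have a: "\<bar>dd f (y + p) v - dd f y v - D p\<bar> \<le> e * (t * (norm v + norm w))"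
      using d2(2)[of "y + p"] np small mult_left_mono[OF np(1) less_imp_le[OF e]] by simp
    have b: "\<bar>dd f (y + q) v - dd f y v - D q\<bar> \<le> e * (t * (norm v + norm w))"
      using d2(2)[of "y + q"] np small mult_left_mono[OF np(2) less_imp_le[OF e]] by simp
    have Dpq: "D p - D q = t * D w" by (simp add: p_def q_def D.add D.scaleR)
    have "\<bar>dd f (y + p) v - dd f (y + q) v - t * D w\<bar> \<le> e * (t * (2 * (norm v + norm w)))"
      using a b Dpq by (simp add: algebra_simps)
    also have "\<dots> \<le> e * (t * N)"
      using e t by (intro mult_left_mono) (auto simp: N_def)
    also have "\<dots> = \<epsilon> * t" using N by (simp add: e_def)
    finally have c: "\<bar>dd f (y + p) v - dd f (y + q) v - t * D w\<bar> \<le> \<epsilon> * t" .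
    have "(f (y + t *\<^sub>R v + t *\<^sub>R w) - f (y + t *\<^sub>R v) - f (y + t *\<^sub>R w) + f y) - t\<^sup>2 * D w
        = t * (dd f (y + p) v - dd f (y + q) v - t * D w)"
      using gs by (simp add: g_def p_def q_def power2_eq_square algebra_simps)
    then have "\<bar>(f (y + t *\<^sub>R v + t *\<^sub>R w) - f (y + t *\<^sub>R v) - f (y + t *\<^sub>R w) + f y) - t\<^sup>2 * D w\<bar>
        = t * \<bar>dd f (y + p) v - dd f (y + q) v - t * D w\<bar>"
      using t by (simp add: abs_mult)
    also have "\<dots> \<le> t * (\<epsilon> * t)" using c t by (intro mult_left_mono) auto
    finally show ?thesis by (simp add: power2_eq_square mult_ac)
  qed
  ultimately show thesis using that by blast
qed

text \<open>
  The second difference is symmetric in \<open>v\<close> and \<open>w\<close>, so both mixed derivatives are its limit after division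
  by \<open>t\<^sup>2\<close>. Vector values are reduced to real ones by pairing with the basis vectors.
\<close>

lemma second_derivative_symmetric:
  fixes f :: "'a::real_normed_vector \<Rightarrow> 'b::euclidean_space"
  assumes "open U" "y \<in> U"
    and diff: "\<And>z. z \<in> U \<Longrightarrow> f differentiable at z"
    and v: "(\<lambda>z. dd f z v) differentiable at y"
    and w: "(\<lambda>z. dd f z w) differentiable at y"
  shows "dd (\<lambda>z. dd f z v) y w = dd (\<lambda>z. dd f z w) y v"
proof (rule euclidean_eqI)
  fix b :: 'b
  define h where "h z = f z \<bullet> b" for z
  have h': "(h has_derivative (\<lambda>u. dd f z u \<bullet> b)) (at z)" if "z \<in> U" for z
    unfolding h_def using dd_works[OF diff[OF that]] by (rule has_derivative_inner_left)
  then have ddh: "dd h z u = dd f z u \<bullet> b" if "z \<in> U" for z u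
    using that dd_eq by blast
  have hdiff: "h differentiable at z" if "z \<in> U" for z
    using h'[OF that] differentiable_def by blast
  have D2: "((\<lambda>z. dd h z u) has_derivative (\<lambda>x. dd (\<lambda>z. dd f z u) y x \<bullet> b)) (at y)"
    if "(\<lambda>z. dd f z u) differentiable at y" for u
    by (rule has_derivative_transform_within_open[OF _ \<open>open U\<close> \<open>y \<in> U\<close> ddh[symmetric]])
       (auto intro!: has_derivative_inner_left dd_works that)
  let ?a = "dd (\<lambda>z. dd f z v) y w \<bullet> b" and ?c = "dd (\<lambda>z. dd f z w) y v \<bullet> b"
  have "\<bar>?a - ?c\<bar> \<le> \<epsilon>" if "\<epsilon> > 0" for \<epsilon>
  proof -
    from that have e2: "\<epsilon> / 2 > 0" by simp
    obtain d1 where d1: "d1 > 0" "\<And>t. 0 < t \<Longrightarrow> t < d1 \<Longrightarrow>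
       \<bar>(h (y + t *\<^sub>R v + t *\<^sub>R w) - h (y + t *\<^sub>R v) - h (y + t *\<^sub>R w) + h y) - t\<^sup>2 * ?a\<bar> \<le> \<epsilon> / 2 * t\<^sup>2"
      using second_difference_quotient[OF \<open>open U\<close> \<open>y \<in> U\<close> hdiff D2[OF v] e2, of w] by blast
    obtain d2 where d2: "d2 > 0" "\<And>t. 0 < t \<Longrightarrow> t < d2 \<Longrightarrow>
       \<bar>(h (y + t *\<^sub>R w + t *\<^sub>R v) - h (y + t *\<^sub>R w) - h (y + t *\<^sub>R v) + h y) - t\<^sup>2 * ?c\<bar> \<le> \<epsilon> / 2 * t\<^sup>2"
      using second_difference_quotient[OF \<open>open U\<close> \<open>y \<in> U\<close> hdiff D2[OF w] e2, of v] by blast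
    define t where "t = min d1 d2 / 2"
    have t: "0 < t" "t < d1" "t < d2" using d1(1) d2(1) by (auto simp: t_def)
    have sw: "y + t *\<^sub>R w + t *\<^sub>R v = y + t *\<^sub>R v + t *\<^sub>R w" by simp
    have "\<bar>t\<^sup>2 * ?a - t\<^sup>2 * ?c\<bar> \<le> \<epsilon> * t\<^sup>2"
      using d1(2)[OF t(1,2)] d2(2)[OF t(1,3)] unfolding sw by linarith
    then have "t\<^sup>2 * \<bar>?a - ?c\<bar> \<le> t\<^sup>2 * \<epsilon>"
      by (simp add: abs_mult right_diff_distrib[symmetric] mult.commute[of \<epsilon>])
    then show ?thesis using t by (simp add: mult_le_cancel_left_pos)
  qed
  then show "?a = ?c" using field_le_epsilon[of "\<bar>?a - ?c\<bar>" 0] by auto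
qed

text \<open>
  If \<open>A m = d\<close> up to an error that is small relative to \<open>m\<close>, then \<open>m\<close> inherits differentiability from
  \<open>d\<close>: injectivity bounds \<open>A\<close> from below, which first makes \<open>m\<close> of the size of \<open>z - y\<close> and thus the error
  \<open>o(z - y)\<close>; a linear left inverse of \<open>A\<close> then produces the derivative.
  This is used twice below: with \<open>m = F z - F y\<close> for a map given implicitly by \<open>\<psi> (F z) = r z\<close>, and with
  \<open>m\<close> the increment of its derivative.
\<close>

lemma has_derivative_implicit:
  fixes A :: "'d::euclidean_space \<Rightarrow> 'b::euclidean_space" and m :: "'c::real_normed_vector \<Rightarrow> 'd"
  assumes A: "linear A" "inj A"
    and m0: "m y = 0" and d0: "d y = 0"
    and d: "(d has_derivative d') (at y)"
    and approx: "\<And>\<epsilon>. \<epsilon> > 0 \<Longrightarrow> \<forall>\<^sub>F z in at y. norm (d z - A (m z)) \<le> \<epsilon> * norm (m z)"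
  obtains m' where "(m has_derivative m') (at y)" "\<And>v. A (m' v) = d' v"
proof -
  obtain c where c: "c > 0" "\<And>x. c * norm x \<le> norm (A x)"
    using linear_inj_bounded_below_pos[OF A] by blast
  obtain P where P: "linear P" "P \<circ> A = id" using linear_injective_left_inverse[OF A] by blast
  then have PA: "P (A x) = x" for x by (metis comp_apply id_apply)
  interpret d': bounded_linear d' using d by (rule has_derivative_bounded_linear)
  have bP: "bounded_linear P" using P(1) linear_conv_bounded_linear by blast
  obtain K where K: "K > 0" "\<And>x. norm (d' x) \<le> norm x * K" using d'.pos_bounded by blast
  obtain L where L: "L > 0" "\<And>x. norm (P x) \<le> norm x * L"
    using bounded_linear.pos_bounded[OF bP] by blast
  \<comment> \<open>A priori bound: with error at most \<open>c / 2\<close> times \<open>m\<close>, half of the lower bound \<open>c\<close> for \<open>A\<close> survives.\<close>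
  have Lm: "\<forall>\<^sub>F z in at y. norm (m z) \<le> 2 * (K + 1) / c * norm (z - y)"
  proof -
    have c2: "c / 2 > 0" using c by simp
    have "\<forall>\<^sub>F z in at y. norm (d z - d y - d' (z - y)) \<le> 1 * norm (z - y)"
      using d unfolding has_derivative_at_alt eventually_at dist_norm by (metis zero_less_one)
    then show ?thesis using approx[OF c2]
    proof eventually_elim
      case (elim z)
      have "norm (d z) \<le> norm (d z - d y - d' (z - y)) + norm (d' (z - y))"
        using d0 norm_triangle_sub[of "d z" "d' (z - y)"] by simp
      also have "\<dots> \<le> (K + 1) * norm (z - y)"
        using elim(1) K(2)[of "z - y"] by (simp add: algebra_simps)
      finally have 1: "norm (d z) \<le> (K + 1) * norm (z - y)" .
      have "c * norm (m z) \<le> norm (A (m z))" by (rule c)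
      also have "\<dots> \<le> norm (d z) + norm (d z - A (m z))"
        using norm_triangle_sub[of "A (m z)" "d z"] by (simp add: norm_minus_commute)
      also have "\<dots> \<le> (K + 1) * norm (z - y) + c / 2 * norm (m z)" using 1 elim(2) by simp
      finally have "c * norm (m z) \<le> 2 * ((K + 1) * norm (z - y))" by simp
      then show ?case using c(1) by (simp add: field_simps)
    qed
  qed
  have rest: "\<forall>\<^sub>F z in at y. norm (d' (z - y) - A (m z)) \<le> \<epsilon> * norm (z - y)" if "\<epsilon> > 0" for \<epsilon>
  proof -
    define N where "N = 2 * (K + 1) / c"
    have N: "N > 0" using K c by (simp add: N_def)
    have e1: "\<epsilon> / (2 * N) > 0" using N that by simp
    have "\<exists>\<delta>>0. \<forall>z. norm (z - y) < \<delta> \<longrightarrow> norm (d z - d y - d' (z - y)) \<le> \<epsilon> / 2 * norm (z - y)"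
      using d that unfolding has_derivative_at_alt by (meson half_gt_zero)
    then have "\<forall>\<^sub>F z in at y. norm (d z - d y - d' (z - y)) \<le> \<epsilon> / 2 * norm (z - y)"
      unfolding eventually_at dist_norm by blast
    then show ?thesis using Lm approx[OF e1]
    proof eventually_elim
      case (elim z)
      have "norm (d' (z - y) - A (m z)) \<le> norm (d z - A (m z)) + norm (d z - d y - d' (z - y))"
        using norm_triangle_ineq4[of "d z - A (m z)" "d z - d y - d' (z - y)"] d0 by simp
      also have "\<dots> \<le> \<epsilon> / (2 * N) * (N * norm (z - y)) + \<epsilon> / 2 * norm (z - y)"
        using elim mult_left_mono[OF elim(2) less_imp_le[OF e1]] unfolding N_def by linarith
      also have "\<dots> = \<epsilon> * norm (z - y)" using N by simp
      finally show ?case .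
    qed
  qed
  have m': "(m has_derivative (\<lambda>v. P (d' v))) (at y)"
    unfolding has_derivative_at_alt
  proof (intro conjI allI impI)
    show "bounded_linear (\<lambda>v. P (d' v))"
      using bounded_linear_compose[OF bP d'.bounded_linear_axioms] .
    fix e :: real assume "e > 0"
    then have "e / L > 0" using L by simp
    from rest[OF this] obtain \<delta> where \<delta>: "\<delta> > 0"
      "\<And>z. z \<noteq> y \<Longrightarrow> norm (z - y) < \<delta> \<Longrightarrow> norm (d' (z - y) - A (m z)) \<le> e / L * norm (z - y)"
      unfolding eventually_at dist_norm by blast
    show "\<exists>\<delta>>0. \<forall>z. norm (z - y) < \<delta> \<longrightarrow> norm (m z - m y - P (d' (z - y))) \<le> e * norm (z - y)"
    proof (intro exI[of _ \<delta>] conjI allI impI \<delta>(1))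
      fix z assume z: "norm (z - y) < \<delta>"
      show "norm (m z - m y - P (d' (z - y))) \<le> e * norm (z - y)"
      proof (cases "z = y")
        case True then show ?thesis using linear_0[OF P(1)] by simp
      next
        case False
        have "m z - m y - P (d' (z - y)) = - P (d' (z - y) - A (m z))"
          using m0 PA by (simp add: linear_diff[OF P(1)])
        then have "norm (m z - m y - P (d' (z - y))) \<le> norm (d' (z - y) - A (m z)) * L"
          using L(2) by simp
        also have "\<dots> \<le> (e / L * norm (z - y)) * L"
          using \<delta>(2)[OF False z] L by (intro mult_right_mono) auto
        also have "\<dots> = e * norm (z - y)" using L by simp
        finally show ?thesis .
      qed
    qed
  qed
  \<comment> \<open>Comparing two derivatives of \<open>A \<circ> m\<close> shows that \<open>d'\<close> takes values in the range of \<open>A\<close>.\<close>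
  have "((\<lambda>z. A (m z)) has_derivative d') (at y)"
    unfolding has_derivative_at_alt
  proof (intro conjI allI impI)
    show "bounded_linear d'" by (rule d'.bounded_linear_axioms)
    fix e :: real assume "e > 0"
    from rest[OF this] obtain \<delta> where \<delta>: "\<delta> > 0"
      "\<And>z. z \<noteq> y \<Longrightarrow> norm (z - y) < \<delta> \<Longrightarrow> norm (d' (z - y) - A (m z)) \<le> e * norm (z - y)"
      unfolding eventually_at dist_norm by blast
    have "norm (A (m z) - A (m y) - d' (z - y)) \<le> e * norm (z - y)" if "norm (z - y) < \<delta>" for z
      using \<delta>(2)[of z] that m0 linear_0[OF A(1)] d'.zero
      by (cases "z = y") (auto simp: norm_minus_commute)
    then show "\<exists>\<delta>>0. \<forall>z. norm (z - y) < \<delta> \<longrightarrow> norm (A (m z) - A (m y) - d' (z - y)) \<le> e * norm (z - y)"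
      using \<delta>(1) by blast
  qed
  moreover have "((\<lambda>z. A (m z)) has_derivative (\<lambda>v. A (P (d' v)))) (at y)"
    using bounded_linear.has_derivative[OF _ m'] A(1) linear_conv_bounded_linear by blast
  ultimately have "A (P (d' v)) = d' v" for v using has_derivative_unique by metis
  with m' show thesis using that by blast
qed

section \<open>Calculus of smooth functions\<close>

lemma dd_differentiable: "open U \<Longrightarrow> f differentiable_on U \<Longrightarrow> y \<in> U \<Longrightarrow> (f has_derivative dd f y) (at y)"
  using differentiable_on_eq_differentiable_at frechet_derivative_works by blast

lemma Ck_on_cong:
  assumes "open U" "\<And>x. x \<in> U \<Longrightarrow> f x = g x" "Ck_on k U f"
  shows "Ck_on k U g"
  using assms(2,3)
proof (induction k arbitrary: f g)
  case 0
  then show ?case using continuous_on_cong by force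
next
  case (Suc k)
  have g': "(g has_derivative dd f x) (at x)" if "x \<in> U" for x
    using has_derivative_transform_within_open[OF _ \<open>open U\<close> that Suc.prems(1)]
      dd_differentiable[OF \<open>open U\<close> _ that, of f] Suc.prems(2) by simp
  then have "g differentiable_on U"
    by (meson assms(1) differentiable_def differentiable_on_eq_differentiable_at)
  moreover have "Ck_on k U (\<lambda>y. dd g y v)" for v
    by (rule Suc.IH[of "\<lambda>y. dd f y v"]) (use g' dd_eq Suc.prems(2) in \<open>fastforce+\<close>)
  ultimately show ?case by simp
qed

lemma Ck_on_SucI:
  assumes "open U" "\<And>x. x \<in> U \<Longrightarrow> (f has_derivative f' x) (at x)" "\<And>v. Ck_on k U (\<lambda>x. f' x v)"
  shows "Ck_on (Suc k) U f"
proof -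
  have "f differentiable_on U"
    by (meson assms(1,2) differentiable_def differentiable_on_eq_differentiable_at)
  moreover have "Ck_on k U (\<lambda>x. dd f x v)" for v
    by (rule Ck_on_cong[OF assms(1) _ assms(3)[of v]]) (use assms(2) dd_eq in metis)
  ultimately show ?thesis by simp
qed

lemma Ck_on_SucD: "Ck_on (Suc k) U f \<Longrightarrow> Ck_on k U f"
proof (induction k arbitrary: f)
  case 0
  then show ?case using differentiable_imp_continuous_on by auto
next
  case (Suc k)
  then show ?case by (metis Ck_on.simps(2))
qed

lemma Ck_on_const: "Ck_on k U (\<lambda>x. c)"
  by (induction k arbitrary: c) auto

lemma Ck_on_bounded_linear:
  assumes "open U" "bounded_linear l" shows "Ck_on k U l"
proof (cases k)
  case 0
  then show ?thesis using assms(2) by (simp add: linear_continuous_on)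
next
  case (Suc j)
  then show ?thesis
    using Ck_on_SucI[OF assms(1), of l "\<lambda>x. l" j] bounded_linear_imp_has_derivative[OF assms(2)] Ck_on_const
    by auto
qed

lemma Ck_on_add:
  assumes "open U" shows "Ck_on k U f \<Longrightarrow> Ck_on k U g \<Longrightarrow> Ck_on k U (\<lambda>x. f x + g x)"
proof (induction k arbitrary: f g)
  case 0
  then show ?case by (simp add: continuous_on_add)
next
  case (Suc k)
  show ?case
    by (rule Ck_on_SucI[OF assms, where f'="\<lambda>x v. dd f x v + dd g x v"])
       (use Suc dd_differentiable[OF assms] in \<open>auto intro!: has_derivative_add\<close>)
qed

lemma Ck_on_sum:
  assumes "open U" "\<And>i. i \<in> I \<Longrightarrow> Ck_on k U (f i)" shows "Ck_on k U (\<lambda>x. \<Sum>i\<in>I. f i x)"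
  using assms(2)
  by (induction I rule: infinite_finite_induct) (auto intro: Ck_on_const Ck_on_add[OF assms(1)])

lemma Ck_on_bilinear:
  assumes "open U" "bounded_bilinear h"
  shows "Ck_on k U f \<Longrightarrow> Ck_on k U g \<Longrightarrow> Ck_on k U (\<lambda>x. h (f x) (g x))"
proof (induction k arbitrary: f g)
  case 0
  then show ?case using bounded_bilinear.continuous_on[OF assms(2)] by auto
next
  case (Suc k)
  show ?case
  proof (rule Ck_on_SucI[OF assms(1)])
    fix x assume "x \<in> U"
    then show "((\<lambda>x. h (f x) (g x)) has_derivative (\<lambda>v. h (f x) (dd g x v) + h (dd f x v) (g x))) (at x)"
      using Suc.prems by (intro bounded_bilinear.FDERIV[OF assms(2)] dd_differentiable[OF assms(1)]) auto
  next
    fix v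
    show "Ck_on k U (\<lambda>x. h (f x) (dd g x v) + h (dd f x v) (g x))"
      using Suc.prems Ck_on_SucD[OF Suc.prems(1)] Ck_on_SucD[OF Suc.prems(2)]
      by (intro Ck_on_add[OF assms(1)] Suc.IH) auto
  qed
qed

lemma Ck_on_linear_left:
  assumes "open U" "bounded_linear l"
  shows "Ck_on k U f \<Longrightarrow> Ck_on k U (\<lambda>x. l (f x))"
proof (induction k arbitrary: f)
  case 0
  then show ?case using bounded_linear.continuous_on[OF assms(2)] by auto
next
  case (Suc k)
  show ?case
    by (rule Ck_on_SucI[OF assms(1), where f'="\<lambda>x v. l (dd f x v)"])
       (use Suc dd_differentiable[OF assms(1)] in \<open>auto intro!: bounded_linear.has_derivative[OF assms(2)]\<close>)
qed

text \<open>
  Needed for functions of the base point alone that are regarded as functions on the tangent bundle.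
\<close>

lemma Ck_on_linear_right:
  assumes "open U" "bounded_linear l"
  shows "Ck_on k U f \<Longrightarrow> Ck_on k (l -` U) (\<lambda>x. f (l x))"
proof (induction k arbitrary: f)
  case 0
  have "continuous_on (l -` U) l" using assms(2) by (simp add: linear_continuous_on)
  with 0 show ?case by (auto intro: continuous_on_compose2)
next
  case (Suc k)
  have op: "open (l -` U)" using assms by (simp add: continuous_open_vimage linear_continuous_at)
  show ?case
  proof (rule Ck_on_SucI[OF op])
    fix x assume "x \<in> l -` U"
    then show "((\<lambda>x. f (l x)) has_derivative (\<lambda>v. dd f (l x) (l v))) (at x)"
      using Suc.prems dd_differentiable[OF assms(1), of f "l x"]
      by (intro has_derivative_compose[OF bounded_linear_imp_has_derivative[OF assms(2)]]) auto
  next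
    fix v show "Ck_on k (l -` U) (\<lambda>x. dd f (l x) (l v))"
      using Suc.IH[of "\<lambda>x. dd f x (l v)"] Suc.prems by simp
  qed
qed

text \<open>
  The derivative \<open>- f' / f\<^sup>2\<close> is a product of \<open>f'\<close> and two copies of the function itself, so the induction
  hypothesis, one order lower, applies to it.
\<close>

lemma Ck_on_inverse:
  fixes f :: "'a::euclidean_space \<Rightarrow> real"
  assumes "open U" "\<And>x. x \<in> U \<Longrightarrow> f x \<noteq> 0"
  shows "Ck_on k U f \<Longrightarrow> Ck_on k U (\<lambda>x. inverse (f x))"
proof (induction k)
  case 0
  then show ?case using assms(2) by (auto intro!: continuous_on_inverse)
next
  case (Suc k)
  show ?case
  proof (rule Ck_on_SucI[OF assms(1)])
    fix x assume "x \<in> U"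
    then show "((\<lambda>x. inverse (f x)) has_derivative (\<lambda>v. - (inverse (f x) * dd f x v * inverse (f x)))) (at x)"
      using Suc.prems assms(2) by (intro Deriv.has_derivative_inverse dd_differentiable[OF assms(1)]) auto
  next
    fix v
    have i: "Ck_on k U (\<lambda>x. inverse (f x))" using Suc Ck_on_SucD by blast
    have d: "Ck_on k U (\<lambda>x. dd f x v)" using Suc.prems by simp
    show "Ck_on k U (\<lambda>x. - (inverse (f x) * dd f x v * inverse (f x)))"
      using Ck_on_linear_left[OF assms(1) bounded_linear_minus[OF bounded_linear_ident]
          Ck_on_bilinear[OF assms(1) bounded_bilinear_mult Ck_on_bilinear[OF assms(1) bounded_bilinear_mult i d] i]] .
  qed
qed

lemma Ck_on_Pair:
  assumes "open U" "Ck_on k U f" "Ck_on k U g"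
  shows "Ck_on k U (\<lambda>x. (f x, g x))"
proof -
  have "Ck_on k U (\<lambda>x. (f x, 0) + (0, g x))"
    using assms by (intro Ck_on_add Ck_on_linear_left[where l="\<lambda>a. (a, 0)"] Ck_on_linear_left[where l="\<lambda>a. (0, a)"]
      bounded_linear_Pair bounded_linear_ident bounded_linear_zero)
  then show ?thesis by simp
qed

lemma smooth_on_has_derivative: "open U \<Longrightarrow> smooth_on U f \<Longrightarrow> y \<in> U \<Longrightarrow> (f has_derivative dd f y) (at y)"
  by (metis Ck_on.simps(2) dd_differentiable smooth_on_def)

lemma smooth_on_dd: "smooth_on U f \<Longrightarrow> smooth_on U (\<lambda>y. dd f y v)"
  unfolding smooth_on_def by (metis Ck_on.simps(2))

lemma smooth_on_differentiable: "open U \<Longrightarrow> smooth_on U f \<Longrightarrow> y \<in> U \<Longrightarrow> f differentiable at y"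
  using smooth_on_has_derivative differentiable_def by blast

lemma smooth_on_Pair:
  "open U \<Longrightarrow> smooth_on U f \<Longrightarrow> smooth_on U g \<Longrightarrow> smooth_on U (\<lambda>x. (f x, g x))"
  unfolding smooth_on_def by (simp add: Ck_on_Pair)

lemma smooth_on_second_symmetric:
  fixes f :: "'a::euclidean_space \<Rightarrow> 'b::euclidean_space"
  assumes "open U" "smooth_on U f" "y \<in> U"
  shows "dd (\<lambda>z. dd f z v) y w = dd (\<lambda>z. dd f z w) y v"
  using assms by (intro second_derivative_symmetric[of U] smooth_on_differentiable smooth_on_dd)

text \<open>
  The device by which a linear map that varies with a parameter is differentiated: its values on the basis
  are differentiated for fixed arguments.
\<close>

lemma linear_basis_expansion:
  fixes v :: "'a::euclidean_space"
  assumes "linear l" shows "l v = (\<Sum>e\<in>Basis. (v \<bullet> e) *\<^sub>R l e)"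
proof -
  have "l v = l (\<Sum>e\<in>Basis. (v \<bullet> e) *\<^sub>R e)" by (simp add: euclidean_representation)
  then show ?thesis using assms by (simp add: linear_sum linear_scale)
qed

lemma smooth_on_linear: "smooth_on U f \<Longrightarrow> open U \<Longrightarrow> y \<in> U \<Longrightarrow> linear (dd f y)"
  using smooth_on_has_derivative has_derivative_linear by blast

lemma smooth_on_tangent_param:
  fixes \<phi> :: "'c::euclidean_space \<Rightarrow> 'a::euclidean_space"
  assumes U: "open U" and s: "smooth_on U \<phi>"
  shows "smooth_on (U \<times> UNIV) (tangent_param \<phi>)"
  unfolding smooth_on_def
proof
  fix k
  have UU: "open (U \<times> (UNIV :: 'c set))" using U by (simp add: open_Times)
  have v: "fst -` U = U \<times> (UNIV :: 'c set)" by auto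
  have k: "Ck_on k U \<phi>" "Ck_on k U (\<lambda>y. dd \<phi> y e)" for e
    using s smooth_on_dd[OF s] by (auto simp: smooth_on_def)
  have pre: "Ck_on k (U \<times> (UNIV :: 'c set)) (\<lambda>p. f (fst p))" if "Ck_on k U f" for f :: "'c \<Rightarrow> 'a"
    using Ck_on_linear_right[OF U _ that, of "fst :: 'c \<times> 'c \<Rightarrow> 'c"] v bounded_linear_fst by auto
  have sum: "Ck_on k (U \<times> (UNIV :: 'c set)) (\<lambda>p. \<Sum>e\<in>Basis. (snd p \<bullet> e) *\<^sub>R dd \<phi> (fst p) e)"
    by (intro Ck_on_sum[OF UU] Ck_on_bilinear[OF UU bounded_bilinear_scaleR] pre k
         Ck_on_bounded_linear[OF UU] bounded_linear_inner_left_comp bounded_linear_snd)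
  show "Ck_on k (U \<times> UNIV) (tangent_param \<phi>)"
    by (rule Ck_on_cong[OF UU _ Ck_on_Pair[OF UU pre[OF k(1)] sum]])
       (auto simp: tangent_param_def linear_basis_expansion[OF smooth_on_linear[OF s U], symmetric])
qed

text \<open>
  The product rule for \<open>A z (k z)\<close> when \<open>A\<close> is only known to be differentiable at each fixed argument.
\<close>

lemma has_derivative_moving_linear:
  fixes A :: "'c::real_normed_vector \<Rightarrow> 'd::euclidean_space \<Rightarrow> 'b::real_normed_vector" and k :: "'c \<Rightarrow> 'd"
  assumes "open U" "y \<in> U" "\<And>z. z \<in> U \<Longrightarrow> linear (A z)"
    and A': "\<And>e. ((\<lambda>z. A z e) has_derivative A' e) (at y)"
    and k: "(k has_derivative k') (at y)"
  shows "((\<lambda>z. A z (k z)) has_derivative (\<lambda>v. A' (k y) v + A y (k' v))) (at y)"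
proof -
  have "((\<lambda>z. \<Sum>e\<in>Basis. (k z \<bullet> e) *\<^sub>R A z e) has_derivative
      (\<lambda>v. \<Sum>e\<in>Basis. (k y \<bullet> e) *\<^sub>R A' e v + (k' v \<bullet> e) *\<^sub>R A y e)) (at y)"
    by (intro has_derivative_sum has_derivative_scaleR has_derivative_inner_left k A')
  moreover have "(\<Sum>e\<in>Basis. (k y \<bullet> e) *\<^sub>R A' e v) = A' (k y) v" for v
  proof -
    have "((\<lambda>z. \<Sum>e\<in>Basis. (k y \<bullet> e) *\<^sub>R A z e) has_derivative (\<lambda>v. \<Sum>e\<in>Basis. (k y \<bullet> e) *\<^sub>R A' e v)) (at y)"
      by (auto intro!: derivative_eq_intros A')
    then have "((\<lambda>z. A z (k y)) has_derivative (\<lambda>v. \<Sum>e\<in>Basis. (k y \<bullet> e) *\<^sub>R A' e v)) (at y)"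
      by (rule has_derivative_transform_within_open[OF _ assms(1,2)]) (metis assms(3) linear_basis_expansion)
    with A'[of "k y"] show ?thesis using has_derivative_unique by metis
  qed
  moreover have "(\<Sum>e\<in>Basis. (k' v \<bullet> e) *\<^sub>R A y e) = A y (k' v)" for v
    using linear_basis_expansion[OF assms(3)[OF assms(2)]] by metis
  ultimately have "((\<lambda>z. \<Sum>e\<in>Basis. (k z \<bullet> e) *\<^sub>R A z e) has_derivative (\<lambda>v. A' (k y) v + A y (k' v))) (at y)"
    by (simp add: sum.distrib)
  then show ?thesis
    by (rule has_derivative_transform_within_open[OF _ assms(1,2)]) (metis assms(3) linear_basis_expansion)
qed

lemma dd_left_inverse:
  assumes "open U" "y \<in> U" "\<And>z. z \<in> U \<Longrightarrow> Q (\<psi> z) = z"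
    and "(\<psi> has_derivative dd \<psi> y) (at y)" and "Q differentiable at (\<psi> y)"
  shows "dd Q (\<psi> y) (dd \<psi> y v) = v"
proof -
  have "((\<lambda>z. Q (\<psi> z)) has_derivative (\<lambda>v. dd Q (\<psi> y) (dd \<psi> y v))) (at y)"
    using has_derivative_compose[OF assms(4) dd_works[OF assms(5)]] .
  then have "((\<lambda>z. z) has_derivative (\<lambda>v. dd Q (\<psi> y) (dd \<psi> y v))) (at y)"
    by (rule has_derivative_transform_within_open[OF _ assms(1-3)])
  then show ?thesis using has_derivative_unique[OF has_derivative_ident] by metis
qed

text \<open>
  A left inverse that is differentiable on the ambient space yields all remaining properties of a local
  parametrization at once: injectivity, continuity of the inverse and, by the chain rule, injectivity of the
  derivative.
\<close>

lemma local_paramI: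
  fixes \<psi> :: "'c::euclidean_space \<Rightarrow> 'a::euclidean_space"
  assumes "open U" "smooth_on U \<psi>" "\<psi> ` U = M \<inter> N" "open N"
    and Q: "\<And>y. y \<in> U \<Longrightarrow> Q (\<psi> y) = y" "\<And>y. y \<in> U \<Longrightarrow> Q differentiable at (\<psi> y)"
  shows "local_param M U \<psi>"
  unfolding local_param_def
proof (intro conjI ballI)
  show "open U" "smooth_on U \<psi>" by fact+
  show "\<psi> ` U \<subseteq> M" using assms(3) by blast
  show "openin (top_of_set M) (\<psi> ` U)" using assms(3,4) by (metis openin_open)
  show inj: "inj_on \<psi> U" using Q(1) by (rule inj_on_inverseI)
  have "continuous_on (\<psi> ` U) Q"
    using Q(2) by (auto intro!: continuous_at_imp_continuous_on differentiable_imp_continuous_within)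
  then show "continuous_on (\<psi> ` U) (inv_into U \<psi>)"
    by (rule continuous_on_eq) (use Q(1) inj in \<open>auto simp: inv_into_f_f\<close>)
  fix y assume y: "y \<in> U"
  have "dd Q (\<psi> y) (dd \<psi> y v) = v" for v
    using dd_left_inverse[OF assms(1) y Q(1) smooth_on_has_derivative[OF assms(1,2) y] Q(2)[OF y]] by blast
  then show "inj (dd \<psi> y)" by (rule inj_on_inverseI)
qed

section \<open>Christoffel symbols of pulled back forms\<close>

text \<open>
  The Riesz representation for a positive definite form; it makes the definite descriptions in the definitions
  of the sharp operator and of the Christoffel symbols meaningful.
\<close>

lemma form_represents:
  fixes b :: "'c::euclidean_space \<Rightarrow> 'c \<Rightarrow> real"
  assumes b: "bilinear b" and pos: "\<And>u. u \<noteq> 0 \<Longrightarrow> b u u > 0" and l: "linear l"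
  shows "\<exists>!z. \<forall>u. b z u = l u"
proof -
  define T where "T z = (\<Sum>e\<in>Basis. b z e *\<^sub>R e)" for z
  have lin: "linear (b z)" "linear (\<lambda>z. b z u)" for z u using b by (auto simp: bilinear_def)
  have T: "linear T"
    by (rule linearI)
      (simp_all add: T_def linear_add[OF lin(2)] linear_scale[OF lin(2)] scaleR_add_left sum.distrib scaleR_sum_right)
  have sum_inner: "(\<Sum>e\<in>Basis. f e *\<^sub>R e) \<bullet> u = (\<Sum>e\<in>Basis. (u \<bullet> e) *\<^sub>R f e)" for f and u :: 'c
    unfolding inner_sum_left by (intro sum.cong refl) (simp add: inner_commute)
  have Tu: "T z \<bullet> u = b z u" for z u
    unfolding T_def sum_inner using linear_basis_expansion[OF lin(1), of z u] by simp
  have "inj T"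
  proof (rule linear_injective_0[THEN iffD2, OF T, rule_format])
    fix z assume "T z = 0"
    then have "b z z = 0" using Tu[of z z] by simp
    then show "z = 0" using pos[of z] by fastforce
  qed
  then have "surj T" using linear_injective_imp_surjective T by blast
  then obtain z where z: "T z = (\<Sum>e\<in>Basis. l e *\<^sub>R e)" by (metis surjD)
  have bz: "b z u = l u" for u
    using Tu[of z u] linear_basis_expansion[OF l, of u] unfolding z sum_inner by simp
  moreover have "z' = z" if "\<forall>u. b z' u = l u" for z'
  proof -
    have "b (z' - z) (z' - z) = 0"
      using that bz linear_diff[OF lin(2)] by simp
    then show ?thesis using pos[of "z' - z"] by fastforce
  qed
  ultimately show ?thesis by blast
qed

lemma sharp_eq:
  assumes "bilinear b" "\<And>u. u \<noteq> 0 \<Longrightarrow> b u u > 0"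
  shows "b (sharp b e) w = e \<bullet> w"
  unfolding sharp_def
  using theI'[OF form_represents[OF assms bounded_linear.linear[OF bounded_linear_inner_right[of e]]]] by blast

text \<open>
  The right hand side of the Koszul formula is linear in \<open>u\<close>, hence represented by a unique vector.
\<close>

lemma christoffel_eq:
  fixes h :: "'c::euclidean_space \<Rightarrow> 'c \<Rightarrow> 'c \<Rightarrow> real"
  assumes W: "open W" "y \<in> W" and bil: "\<And>z. z \<in> W \<Longrightarrow> bilinear (h z)"
    and diff: "\<And>a b. (\<lambda>z. h z a b) differentiable at y"
    and pos: "\<And>u. u \<noteq> 0 \<Longrightarrow> h y u u > 0"
  shows "2 * h y (christoffel h y v w) u =
    dd (\<lambda>z. h z w u) y v + dd (\<lambda>z. h z v u) y w - dd (\<lambda>z. h z v w) y u"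
proof -
  have lin: "linear (h z a)" if "z \<in> W" for z a using bil[OF that] by (simp add: bilinear_def)
  have lin1: "linear (\<lambda>u. dd (\<lambda>z. h z a u) y b)" for a b
  proof (rule linearI)
    fix u u' and t :: real
    have "((\<lambda>z. h z a u + h z a u') has_derivative (\<lambda>b. dd (\<lambda>z. h z a u) y b + dd (\<lambda>z. h z a u') y b)) (at y)"
      by (intro has_derivative_add dd_works diff)
    then have "((\<lambda>z. h z a (u + u')) has_derivative (\<lambda>b. dd (\<lambda>z. h z a u) y b + dd (\<lambda>z. h z a u') y b)) (at y)"
      by (rule has_derivative_transform_within_open[OF _ W]) (simp add: linear_add[OF lin])
    then show "dd (\<lambda>z. h z a (u + u')) y b = dd (\<lambda>z. h z a u) y b + dd (\<lambda>z. h z a u') y b"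
      by (rule dd_eq)
    have "((\<lambda>z. t *\<^sub>R h z a u) has_derivative (\<lambda>b. t *\<^sub>R dd (\<lambda>z. h z a u) y b)) (at y)"
      by (intro has_derivative_scaleR_right dd_works diff)
    then have "((\<lambda>z. h z a (t *\<^sub>R u)) has_derivative (\<lambda>b. t *\<^sub>R dd (\<lambda>z. h z a u) y b)) (at y)"
      by (rule has_derivative_transform_within_open[OF _ W]) (simp add: linear_scale[OF lin])
    then show "dd (\<lambda>z. h z a (t *\<^sub>R u)) y b = t *\<^sub>R dd (\<lambda>z. h z a u) y b"
      by (rule dd_eq)
  qed
  define l where "l u = dd (\<lambda>z. h z w u) y v + dd (\<lambda>z. h z v u) y w - dd (\<lambda>z. h z v w) y u" for u
  have "linear l" unfolding l_def
    by (intro linear_compose_sub linear_compose_add lin1 linear_frechet_derivative diff)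
  moreover have "bilinear (\<lambda>z u. 2 * h y z u)"
    using bil[OF W(2)] unfolding bilinear_def
    by (auto intro!: linear_compose_scale_right[where 'b=real, simplified])
  ultimately have "\<exists>!z. \<forall>u. 2 * h y z u = l u"
    by (intro form_represents) (use pos in auto)
  from theI'[OF this] show ?thesis unfolding christoffel_def l_def by blast
qed

lemma has_derivative_moving_bilinear:
  fixes B :: "'c::real_normed_vector \<Rightarrow> 'd::euclidean_space \<Rightarrow> 'd \<Rightarrow> real"
  assumes W: "open W" "y \<in> W" and bil: "\<And>z. z \<in> W \<Longrightarrow> bilinear (B z)"
    and B': "\<And>a b. ((\<lambda>z. B z a b) has_derivative (\<lambda>v. B' v a b)) (at y)"
    and p: "(p has_derivative p') (at y)" and q: "(q has_derivative q') (at y)"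
  shows "((\<lambda>z. B z (p z) (q z)) has_derivative
     (\<lambda>v. B' v (p y) (q y) + B y (p' v) (q y) + B y (p y) (q' v))) (at y)"
proof -
  have 1: "((\<lambda>z. B z (p z) e) has_derivative (\<lambda>v. B' v (p y) e + B y (p' v) e)) (at y)" for e
    by (rule has_derivative_moving_linear[where A="\<lambda>z x. B z x e" and A'="\<lambda>x v. B' v x e", OF W _ B' p])
       (use bil in \<open>simp add: bilinear_def\<close>)
  show ?thesis
    by (rule has_derivative_moving_linear[where A="\<lambda>z. B z (p z)"
          and A'="\<lambda>e v. B' v (p y) e + B y (p' v) e", OF W _ 1 q])
       (use bil in \<open>simp add: bilinear_def\<close>)
qed

text \<open>
  Differentiating \<open>H (\<psi> z) (d\<psi> a) (d\<psi> b)\<close> gives a derivative of \<open>H\<close> and two terms with \<open>D\<^sup>2\<psi>\<close>. In the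
  Koszul combination, symmetry of \<open>D\<^sup>2\<psi>\<close> and of \<open>H\<close> cancels all terms with \<open>D\<^sup>2\<psi>\<close> except the one that
  pairs \<open>D\<^sup>2\<psi>(v, w)\<close> with \<open>d\<psi> u\<close>, and this one occurs twice.
\<close>

lemma christoffel_pullback:
  fixes \<psi> :: "'c::euclidean_space \<Rightarrow> 'e::euclidean_space"
  assumes W: "open W" "y \<in> W" and s: "smooth_on W \<psi>"
    and h: "\<And>z a b. z \<in> W \<Longrightarrow> h z a b = H (\<psi> z) (dd \<psi> z a) (dd \<psi> z b)"
    and bil: "\<And>p. bilinear (H p)" and sym: "\<And>p A B. H p A B = H p B A"
    and DH: "\<And>A B. ((\<lambda>p. H p A B) has_derivative (\<lambda>C. DH C A B)) (at (\<psi> y))"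
    and pos: "\<And>u. u \<noteq> 0 \<Longrightarrow> h y u u > 0"
  shows "2 * H (\<psi> y) (dd \<psi> y (christoffel h y v w)) (dd \<psi> y u) =
     DH (dd \<psi> y v) (dd \<psi> y w) (dd \<psi> y u) + DH (dd \<psi> y w) (dd \<psi> y v) (dd \<psi> y u)
     - DH (dd \<psi> y u) (dd \<psi> y v) (dd \<psi> y w)
     + 2 * H (\<psi> y) (dd (\<lambda>z. dd \<psi> z w) y v) (dd \<psi> y u)"
proof -
  define D2 where "D2 a c = dd (\<lambda>z. dd \<psi> z a) y c" for a c
  have D2sym: "D2 a c = D2 c a" for a c
    unfolding D2_def by (rule smooth_on_second_symmetric[OF W(1) s W(2)])
  have d: "((\<lambda>z. dd \<psi> z a) has_derivative D2 a) (at y)" for a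
    unfolding D2_def using smooth_on_has_derivative[OF W(1) smooth_on_dd[OF s] W(2)] by simp
  have "((\<lambda>z. H (\<psi> z) (dd \<psi> z a) (dd \<psi> z b)) has_derivative
     (\<lambda>c. DH (dd \<psi> y c) (dd \<psi> y a) (dd \<psi> y b) + H (\<psi> y) (D2 a c) (dd \<psi> y b)
         + H (\<psi> y) (dd \<psi> y a) (D2 b c))) (at y)" for a b
    by (rule has_derivative_moving_bilinear[OF W bil _ d d, where B'="\<lambda>c. DH (dd \<psi> y c)"])
       (rule has_derivative_compose[OF smooth_on_has_derivative[OF W(1) s W(2)] DH])
  then have hd: "((\<lambda>z. h z a b) has_derivative
     (\<lambda>c. DH (dd \<psi> y c) (dd \<psi> y a) (dd \<psi> y b) + H (\<psi> y) (D2 a c) (dd \<psi> y b)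
         + H (\<psi> y) (dd \<psi> y a) (D2 b c))) (at y)" for a b
    by (rule has_derivative_transform_within_open[OF _ W]) (simp add: h)
  have lin: "linear (dd \<psi> z)" if "z \<in> W" for z using smooth_on_linear[OF s W(1) that] .
  have hb: "bilinear (h z)" if "z \<in> W" for z
  proof -
    have "h z = (\<lambda>a b. H (\<psi> z) (dd \<psi> z a) (dd \<psi> z b))" using h[OF that] by blast
    moreover have "linear (H (\<psi> z) A)" "linear (\<lambda>A. H (\<psi> z) A B)" for A B
      using bil[of "\<psi> z"] by (auto simp: bilinear_def)
    ultimately show ?thesis
      using linear_compose[OF lin[OF that], of "H (\<psi> z) A" for A]
        linear_compose[OF lin[OF that], of "\<lambda>A. H (\<psi> z) A B" for B]
      by (simp add: bilinear_def o_def)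
  qed
  have "2 * h y (christoffel h y v w) u =
    dd (\<lambda>z. h z w u) y v + dd (\<lambda>z. h z v u) y w - dd (\<lambda>z. h z v w) y u"
    by (rule christoffel_eq[where h=h, OF W hb _ pos]) (auto intro: Derivative.differentiableI[OF hd])
  then show ?thesis
    unfolding dd_eq[OF hd] h[OF W(2)] D2_def[symmetric]
    using D2sym[of u v] D2sym[of u w] D2sym[of v w] sym by (simp add: algebra_simps)
qed

section \<open>Lifting maps through an immersion and the second fundamental form of a map\<close>

text \<open>
  Here \<open>F\<close> is only known to be continuous. Differentiability of \<open>\<psi>\<close> at \<open>F z\<close> says that \<open>d\<psi> (F x - F z)\<close>
  equals \<open>r x - r z\<close> up to an error that is small relative to \<open>F x - F z\<close>.
\<close>

lemma lift_through_immersion: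
  fixes \<psi> :: "'d::euclidean_space \<Rightarrow> 'e::euclidean_space" and F :: "'c::euclidean_space \<Rightarrow> 'd"
  assumes W: "open W" and s: "smooth_on W \<psi>" and inj: "\<And>q. q \<in> W \<Longrightarrow> inj (dd \<psi> q)"
    and U: "open U" and FW: "\<And>z. z \<in> U \<Longrightarrow> F z \<in> W" and cont: "continuous_on U F"
    and r: "\<And>z. z \<in> U \<Longrightarrow> \<psi> (F z) = r z" and r': "\<And>z. z \<in> U \<Longrightarrow> r differentiable at z"
    and z: "z \<in> U"
  shows "(F has_derivative dd F z) (at z)" and "dd \<psi> (F z) (dd F z w) = dd r z w"
proof -
  have Fc: "isCont F z" using cont U z continuous_on_eq_continuous_at by blast
  obtain m' where m': "((\<lambda>x. F x - F z) has_derivative m') (at z)" "\<And>v. dd \<psi> (F z) (m' v) = dd r z v"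
  proof (rule has_derivative_implicit[of "dd \<psi> (F z)" "\<lambda>x. F x - F z" z "\<lambda>x. r x - r z" "dd r z"])
    show "linear (dd \<psi> (F z))" using smooth_on_linear[OF s W FW[OF z]] .
    show "inj (dd \<psi> (F z))" using inj[OF FW[OF z]] .
    show "((\<lambda>x. r x - r z) has_derivative dd r z) (at z)"
      using has_derivative_diff[OF dd_works[OF r'[OF z]] has_derivative_const] by simp
  next
    fix \<epsilon> :: real assume "\<epsilon> > 0"
    then obtain \<delta> where \<delta>: "\<delta> > 0" "\<And>x. norm (x - F z) < \<delta> \<Longrightarrow>
       norm (\<psi> x - \<psi> (F z) - dd \<psi> (F z) (x - F z)) \<le> \<epsilon> * norm (x - F z)"
      using smooth_on_has_derivative[OF W s FW[OF z]] unfolding has_derivative_at_alt by blast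
    have "\<forall>\<^sub>F x in at z. norm (F x - F z) < \<delta>"
      using tendstoD[OF Fc[unfolded isCont_def] \<delta>(1)] by (simp add: dist_norm)
    moreover have "\<forall>\<^sub>F x in at z. x \<in> U" using eventually_at_topological U z by blast
    ultimately show "\<forall>\<^sub>F x in at z. norm (r x - r z - dd \<psi> (F z) (F x - F z)) \<le> \<epsilon> * norm (F x - F z)"
      by eventually_elim (use \<delta>(2) r z in metis)
  qed auto
  have "((\<lambda>x. (F x - F z) + F z) has_derivative (\<lambda>v. m' v + 0)) (at z)"
    by (intro has_derivative_add m' has_derivative_const)
  then have F': "(F has_derivative m') (at z)" by simp
  then show "(F has_derivative dd F z) (at z)" using dd_works differentiable_def by blast
  show "dd \<psi> (F z) (dd F z w) = dd r z w" using m'(2) dd_eq[OF F'] by simp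
qed

text \<open>
  Differentiating \<open>d\<psi>(dF w) = dr w\<close> once more. That \<open>dF w\<close> is differentiable at all is part of the
  assertion, since otherwise its derivative would have no specified value.
\<close>

lemma second_derivative_lift:
  fixes \<psi> :: "'d::euclidean_space \<Rightarrow> 'e::euclidean_space" and F :: "'c::euclidean_space \<Rightarrow> 'd"
  assumes W: "open W" and s: "smooth_on W \<psi>" and inj: "\<And>q. q \<in> W \<Longrightarrow> inj (dd \<psi> q)"
    and U: "open U" and FW: "\<And>z. z \<in> U \<Longrightarrow> F z \<in> W" and cont: "continuous_on U F"
    and r: "\<And>z. z \<in> U \<Longrightarrow> \<psi> (F z) = r z" and r': "\<And>z. z \<in> U \<Longrightarrow> r differentiable at z"
    and y: "y \<in> U" and r'': "(\<lambda>z. dd r z w) differentiable at y"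
  shows "dd (\<lambda>z. dd r z w) y v =
     dd (\<lambda>q. dd \<psi> q (dd F y w)) (F y) (dd F y v) + dd \<psi> (F y) (dd (\<lambda>z. dd F z w) y v)"
proof -
  note lift = lift_through_immersion[OF W s inj U FW cont r r']
  define k where "k z = dd F z w" for z
  define A where "A z = dd \<psi> (F z)" for z
  have lin: "linear (A z)" if "z \<in> U" for z unfolding A_def using smooth_on_linear[OF s W FW[OF that]] .
  have injA: "inj (A y)" unfolding A_def using inj[OF FW[OF y]] .
  have A': "((\<lambda>z. A z e) has_derivative (\<lambda>v. dd (\<lambda>q. dd \<psi> q e) (F y) (dd F y v))) (at y)" for e
    unfolding A_def
    by (rule has_derivative_compose[OF lift(1)[OF _ _ _ _ y] smooth_on_has_derivative[OF W smooth_on_dd[OF s] FW[OF y]]])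
  \<comment> \<open>Subtracting the part with frozen argument \<open>k y\<close> leaves \<open>A z (k z - k y)\<close>, which differs from \<open>A y (k z - k y)\<close> by a relatively small error.\<close>
  define d where "d z = dd r z w - A z (k y)" for z
  define d' where "d' v = dd (\<lambda>z. dd r z w) y v - dd (\<lambda>q. dd \<psi> q (k y)) (F y) (dd F y v)" for v
  have Ak: "A z (k z) = dd r z w" if "z \<in> U" for z
    unfolding A_def k_def using lift(2)[OF _ _ _ _ that] by simp
  obtain m' where m': "((\<lambda>z. k z - k y) has_derivative m') (at y)" "\<And>v. A y (m' v) = d' v"
  proof (rule has_derivative_implicit[of "A y" "\<lambda>z. k z - k y" y d d'])
    show "d y = 0" using Ak[OF y] by (simp add: d_def)
    show "(d has_derivative d') (at y)"
      unfolding d_def d'_def by (intro has_derivative_diff dd_works[OF r''] A')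
  next
    fix \<epsilon> :: real assume \<epsilon>: "\<epsilon> > 0"
    define n where "n = real DIM('d)"
    have n: "n > 0" by (simp add: n_def)
    have "\<forall>\<^sub>F z in at y. \<forall>e\<in>Basis. norm (A z e - A y e) < \<epsilon> / n"
    proof (rule eventually_ball_finite[OF finite_Basis], rule ballI)
      fix e :: 'd
      have "isCont (\<lambda>z. A z e) y" using has_derivative_continuous[OF A'] .
      then show "\<forall>\<^sub>F z in at y. norm (A z e - A y e) < \<epsilon> / n"
        using tendstoD[of "\<lambda>z. A z e" "A y e" "at y" "\<epsilon> / n"] \<epsilon> n by (simp add: isCont_def dist_norm)
    qed
    moreover have "\<forall>\<^sub>F z in at y. z \<in> U" using eventually_at_topological U y by blast
    ultimately show "\<forall>\<^sub>F z in at y. norm (d z - A y (k z - k y)) \<le> \<epsilon> * norm (k z - k y)"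
    proof eventually_elim
      case (elim z)
      let ?m = "k z - k y"
      have "d z - A y ?m = A z ?m - A y ?m"
        using Ak[OF elim(2)] linear_diff[OF lin[OF elim(2)]] by (simp add: d_def)
      also have "\<dots> = (\<Sum>e\<in>Basis. (?m \<bullet> e) *\<^sub>R (A z e - A y e))"
        using linear_basis_expansion[OF lin[OF elim(2)], of ?m] linear_basis_expansion[OF lin[OF y], of ?m]
        by (simp add: sum_subtractf scaleR_diff_right)
      also have "norm \<dots> \<le> (\<Sum>e\<in>(Basis::'d set). norm ?m * (\<epsilon> / n))"
        using elim(1) by (intro order_trans[OF norm_sum] sum_mono)
          (simp only: norm_scaleR, intro mult_mono Basis_le_norm, auto intro: less_imp_le)
      also have "\<dots> = \<epsilon> * norm ?m" using n by (simp add: n_def)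
      finally show ?case .
    qed
  qed (use lin[OF y] injA in auto)
  have "((\<lambda>x. (k x - k y) + k y) has_derivative (\<lambda>v. m' v + 0)) (at y)"
    by (intro has_derivative_add m' has_derivative_const)
  then have k': "(k has_derivative m') (at y)" by simp
  have "dd k y v = m' v" using dd_eq[OF k'] .
  then have "A y (dd k y v) = d' v" using m' by simp
  then show ?thesis by (simp add: A_def d'_def k_def[abs_def])
qed

text \<open>
  By \<open>christoffel_pullback\<close> the Christoffel term of the target contributes \<open>D\<^sup>2\<psi>(dF v, dF w)\<close>, and by
  \<open>second_derivative_lift\<close> this completes \<open>d\<psi>(D\<^sup>2F(v, w))\<close> to \<open>D\<^sup>2(\<psi> \<circ> F)(v, w)\<close>.
\<close>

lemma nabla_d_formula:
  fixes \<psi> :: "'d::euclidean_space \<Rightarrow> 'e::euclidean_space" and F :: "'c::euclidean_space \<Rightarrow> 'd"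
  assumes W: "open W" and s: "smooth_on W \<psi>" and inj: "\<And>q. q \<in> W \<Longrightarrow> inj (dd \<psi> q)"
    and U: "open U" and FW: "\<And>z. z \<in> U \<Longrightarrow> F z \<in> W" and cont: "continuous_on U F"
    and r: "\<And>z. z \<in> U \<Longrightarrow> \<psi> (F z) = r z" and r': "\<And>z. z \<in> U \<Longrightarrow> r differentiable at z"
    and y: "y \<in> U" and r'': "(\<lambda>z. dd r z w) differentiable at y"
    and h: "\<And>q a b. q \<in> W \<Longrightarrow> h q a b = H (\<psi> q) (dd \<psi> q a) (dd \<psi> q b)"
    and bil: "\<And>p. bilinear (H p)" and sym: "\<And>p A B. H p A B = H p B A"
    and DH: "\<And>A B. ((\<lambda>p. H p A B) has_derivative (\<lambda>C. DH C A B)) (at (r y))"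
    and pos: "\<And>u. u \<noteq> 0 \<Longrightarrow> h (F y) u u > 0"
  shows "2 * H (r y) (dd \<psi> (F y) (nabla_d g h F y v w)) (dd \<psi> (F y) c) =
     2 * H (r y) (dd (\<lambda>z. dd r z w) y v - dd r y (christoffel g y v w)) (dd \<psi> (F y) c)
     + DH (dd r y v) (dd r y w) (dd \<psi> (F y) c) + DH (dd r y w) (dd r y v) (dd \<psi> (F y) c)
     - DH (dd \<psi> (F y) c) (dd r y v) (dd r y w)"
proof -
  note lift = lift_through_immersion[OF W s inj U FW cont r r' y]
  have lin: "linear (dd \<psi> (F y))" using smooth_on_linear[OF s W FW[OF y]] .
  have 2: "dd (\<lambda>z. dd r z w) y v =
     dd (\<lambda>q. dd \<psi> q (dd F y w)) (F y) (dd F y v) + dd \<psi> (F y) (dd (\<lambda>z. dd F z w) y v)"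
    by (rule second_derivative_lift[OF W s inj U FW cont r r' y r''])
  have Hl: "linear (\<lambda>A. H p A B)" for p B using bil[of p] by (simp add: bilinear_def)
  have DH': "((\<lambda>p. H p A B) has_derivative (\<lambda>C. DH C A B)) (at (\<psi> (F y)))" for A B
    using DH r[OF y] by simp
  note K = christoffel_pullback[OF W FW[OF y] s h bil sym DH' pos, where v="dd F y v" and w="dd F y w" and u=c,
    unfolded r[OF y]]
  show ?thesis
    using K unfolding nabla_d_def 2 lift(2)
    by (simp add: linear_add[OF lin] linear_diff[OF lin] linear_add[OF Hl] linear_diff[OF Hl] lift(2))
qed

section \<open>The round sphere and its tangent bundle\<close>

lemma has_derivative_const_on_open:
  assumes "(f has_derivative f') (at y)" "open U" "y \<in> U" "\<And>z. z \<in> U \<Longrightarrow> f z = c"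
  shows "f' v = 0"
proof -
  have "((\<lambda>z. c) has_derivative f') (at y)"
    by (rule has_derivative_transform_within_open[OF assms(1-3)]) (use assms(4) in simp)
  then show ?thesis using has_derivative_unique[OF has_derivative_const] by metis
qed

lemma tangent_space_sphere:
  fixes x :: "'a::euclidean_space"
  assumes x: "x \<in> sphere 0 1"
  shows "tangent_space (sphere 0 1) x = {X. X \<bullet> x = 0}"
proof (intro equalityI subsetI)
  fix X assume "X \<in> tangent_space (sphere 0 1) x"
  then obtain c where c: "c 0 = x" "\<forall>\<^sub>F t in at 0. c t \<in> sphere 0 1" "(c has_vector_derivative X) (at 0)"
    unfolding tangent_space_def by auto
  have "((\<lambda>t. c t \<bullet> c t) has_derivative (\<lambda>t. c 0 \<bullet> (t *\<^sub>R X) + (t *\<^sub>R X) \<bullet> c 0)) (at 0)"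
    using c(3) unfolding has_vector_derivative_def by (intro has_derivative_inner)
  then have "((\<lambda>t. 1) has_derivative (\<lambda>t. c 0 \<bullet> (t *\<^sub>R X) + (t *\<^sub>R X) \<bullet> c 0)) (at (0::real))"
  proof (rule has_derivative_transform_eventually)
    show "\<forall>\<^sub>F t in at 0. c t \<bullet> c t = 1"
      using c(2) by eventually_elim (simp add: norm_eq_1)
  qed (use c(1) x in \<open>auto simp: norm_eq_1\<close>)
  then have "(\<lambda>t. c 0 \<bullet> (t *\<^sub>R X) + (t *\<^sub>R X) \<bullet> c 0) = (\<lambda>t. 0)"
    using has_derivative_unique has_derivative_const by blast
  from fun_cong[OF this, of 1] show "X \<in> {X. X \<bullet> x = 0}" by (simp add: c(1) inner_commute)
next
  fix X assume X: "X \<in> {X. X \<bullet> x = 0}"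
  have xx: "x \<bullet> x = 1" using x by (simp add: norm_eq_1)
  define n where "n t = 1 + t\<^sup>2 * (X \<bullet> X)" for t :: real
  have n: "n t > 0" for t unfolding n_def by (intro add_pos_nonneg) auto
  define c where "c t = (1 / sqrt (n t)) *\<^sub>R (x + t *\<^sub>R X)" for t
  have "c t \<bullet> c t = 1" for t
  proof -
    have "(x + t *\<^sub>R X) \<bullet> (x + t *\<^sub>R X) = n t"
      using X xx by (simp add: n_def inner_simps inner_commute power2_eq_square)
    then show ?thesis using n[of t] by (simp add: c_def)
  qed
  then have "c t \<in> sphere 0 1" for t by (simp add: norm_eq_1)
  moreover have "c 0 = x" by (simp add: c_def n_def)
  moreover have "(c has_vector_derivative X) (at 0)"
    unfolding c_def n_def has_vector_derivative_def
    by (auto intro!: derivative_eq_intros simp: power2_eq_square)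
  ultimately show "X \<in> tangent_space (sphere 0 1) x" unfolding tangent_space_def by auto
qed

lemma tangent_bundle_sphere:
  "tangent_bundle (sphere 0 1) = {(x :: 'a::euclidean_space, u). norm x = 1 \<and> u \<bullet> x = 0}"
  unfolding tangent_bundle_def using tangent_space_sphere by auto

text \<open>
  Constraints obtained by differentiating \<open>x \<bullet> x = 1\<close> and \<open>u \<bullet> x = 0\<close>. A curve with the given velocity
  arises from \<open>u + t W\<close> by projection to the tangent space at the moving base point.
\<close>

lemma tangent_space_tangent_bundle_sphereI:
  fixes x u X W :: "'a::euclidean_space"
  assumes x: "norm x = 1" and u: "u \<bullet> x = 0" and X: "X \<bullet> x = 0" and W: "W \<bullet> x + X \<bullet> u = 0"
  shows "(X, W) \<in> tangent_space (tangent_bundle (sphere 0 1)) (x, u)"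
proof -
  have "X \<in> tangent_space (sphere 0 1) x" using tangent_space_sphere[of x] x X by simp
  then obtain a where a: "a 0 = x" "\<forall>\<^sub>F t in at 0. a t \<in> sphere 0 1" "(a has_vector_derivative X) (at 0)"
    unfolding tangent_space_def by auto
  define b where "b t = (u + t *\<^sub>R W) - (a t \<bullet> (u + t *\<^sub>R W)) *\<^sub>R a t" for t
  have "\<forall>\<^sub>F t in at 0. (a t, b t) \<in> tangent_bundle (sphere 0 1)"
    using a(2)
  proof eventually_elim
    case (elim t)
    then have "a t \<bullet> a t = 1" by (simp add: norm_eq_1)
    then have "b t \<bullet> a t = 0" by (simp add: b_def inner_diff_left inner_commute[of "a t" "u + t *\<^sub>R W"])
    then show ?case using elim by (simp add: tangent_bundle_sphere)
  qed
  moreover have "b 0 = u" using u a(1) by (simp add: b_def inner_commute)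
  moreover have "(b has_vector_derivative W) (at 0)"
  proof -
    have d: "(a has_derivative (\<lambda>t. t *\<^sub>R X)) (at 0)" using a(3) by (simp add: has_vector_derivative_def)
    have l: "((\<lambda>t. u + t *\<^sub>R W) has_derivative (\<lambda>t. t *\<^sub>R W)) (at 0)"
      by (auto intro!: derivative_eq_intros)
    have "(b has_derivative (\<lambda>t. t *\<^sub>R W - ((a 0 \<bullet> (u + 0 *\<^sub>R W)) *\<^sub>R (t *\<^sub>R X)
       + (a 0 \<bullet> (t *\<^sub>R W) + (t *\<^sub>R X) \<bullet> (u + 0 *\<^sub>R W)) *\<^sub>R a 0))) (at 0)"
      unfolding b_def by (intro has_derivative_diff has_derivative_scaleR has_derivative_inner l d)
    moreover have "(a 0 \<bullet> (u + 0 *\<^sub>R W)) *\<^sub>R (t *\<^sub>R X)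
       + (a 0 \<bullet> (t *\<^sub>R W) + (t *\<^sub>R X) \<bullet> (u + 0 *\<^sub>R W)) *\<^sub>R a 0 = 0" for t
    proof -
      have "a 0 \<bullet> (t *\<^sub>R W) + (t *\<^sub>R X) \<bullet> (u + 0 *\<^sub>R W) = t * (W \<bullet> x + X \<bullet> u)"
        by (simp add: a(1) inner_commute algebra_simps)
      then show ?thesis using W u by (simp add: a(1) inner_commute)
    qed
    ultimately show ?thesis by (simp add: has_vector_derivative_def)
  qed
  ultimately show ?thesis
    unfolding tangent_space_def using a(1) has_vector_derivative_Pair[OF a(3)]
    by (intro CollectI exI[of _ "\<lambda>t. (a t, b t)"]) auto
qed

lemma local_paramD:
  assumes "local_param M U \<phi>"
  shows "open U" "smooth_on U \<phi>" "\<And>y. y \<in> U \<Longrightarrow> \<phi> y \<in> M" "\<And>y. y \<in> U \<Longrightarrow> inj (dd \<phi> y)"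
    "inj_on \<phi> U" "continuous_on (\<phi> ` U) (inv_into U \<phi>)" "openin (top_of_set M) (\<phi> ` U)"
  using assms unfolding local_param_def by auto

text \<open>
  Differentiate \<open>\<phi> \<bullet> \<phi> = 1\<close> once and twice.
\<close>

lemma sphere_param_tangent:
  fixes \<phi> :: "'c::euclidean_space \<Rightarrow> 'a::euclidean_space"
  assumes "open U" "smooth_on U \<phi>" "\<phi> ` U \<subseteq> sphere 0 1" "y \<in> U"
  shows "dd \<phi> y v \<bullet> \<phi> y = 0"
    and "dd (\<lambda>z. dd \<phi> z w) y v \<bullet> \<phi> y = - (dd \<phi> y v \<bullet> dd \<phi> y w)"
proof -
  have norm: "\<phi> z \<bullet> \<phi> z = 1" if "z \<in> U" for z
    using assms(3) that by (metis imageI mem_sphere_0 norm_eq_1 subset_eq)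
  have d: "(\<phi> has_derivative dd \<phi> z) (at z)" if "z \<in> U" for z
    using smooth_on_has_derivative[OF assms(1,2) that] .
  have 1: "dd \<phi> z v \<bullet> \<phi> z = 0" if "z \<in> U" for z v
    using has_derivative_const_on_open[OF has_derivative_inner[OF d d, OF that that] assms(1) that norm, of v]
    by (simp add: inner_commute)
  then show "dd \<phi> y v \<bullet> \<phi> y = 0" using assms(4) by simp
  have "((\<lambda>z. dd \<phi> z w) has_derivative dd (\<lambda>z. dd \<phi> z w) y) (at y)"
    using smooth_on_has_derivative[OF assms(1) smooth_on_dd[OF assms(2)] assms(4)] .
  from has_derivative_const_on_open[OF has_derivative_inner[OF this d[OF assms(4)]] assms(1,4) 1, of v]
  show "dd (\<lambda>z. dd \<phi> z w) y v \<bullet> \<phi> y = - (dd \<phi> y v \<bullet> dd \<phi> y w)"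
    by (simp add: inner_commute)
qed

lemma sphere_param_range:
  fixes \<phi> :: "'c::euclidean_space \<Rightarrow> 'a::euclidean_space"
  assumes dim: "DIM('a) = DIM('c) + 1"
    and "open U" "smooth_on U \<phi>" "\<phi> ` U \<subseteq> sphere 0 1" "y \<in> U" and inj: "inj (dd \<phi> y)"
  shows "range (dd \<phi> y) = {X. X \<bullet> \<phi> y = 0}"
proof (rule subspace_dim_equal)
  have lin: "linear (dd \<phi> y)" using smooth_on_linear[OF assms(3,2,5)] .
  have n: "\<phi> y \<noteq> 0" using assms(4,5) by auto
  have eq: "{X. X \<bullet> \<phi> y = 0} = {X. \<phi> y \<bullet> X = 0}" by (simp add: inner_commute)
  show "subspace (range (dd \<phi> y))" using lin linear_subspace_image subspace_UNIV by blast
  show "subspace {X. X \<bullet> \<phi> y = 0}" unfolding eq by (rule subspace_hyperplane)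
  show "range (dd \<phi> y) \<subseteq> {X. X \<bullet> \<phi> y = 0}" using sphere_param_tangent(1)[OF assms(2-5)] by auto
  have "dim (range (dd \<phi> y)) = DIM('c)"
    using dim_image_eq[OF lin, of UNIV] inj by simp
  then show "dim {X. X \<bullet> \<phi> y = 0} \<le> dim (range (dd \<phi> y))"
    unfolding eq using dim_hyperplane[OF n] dim by simp
qed

text \<open>
  The Gauss formula. The Koszul formula with the constant ambient inner product says that the left hand side is
  orthogonal to the image of \<open>d\<phi>\<close>, which is the full tangent space by dimension; its normal component is the
  one of \<open>D\<^sup>2\<phi>\<close>.
\<close>

lemma sphere_christoffel:
  fixes \<phi> :: "'c::euclidean_space \<Rightarrow> 'a::euclidean_space"
  assumes dim: "DIM('a) = DIM('c) + 1" and \<phi>: "local_param (sphere 0 1) U \<phi>" and y: "y \<in> U"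
  shows "dd (\<lambda>z. dd \<phi> z w) y v - dd \<phi> y (christoffel (coord_metric canonical_metric \<phi>) y v w)
     = - (dd \<phi> y v \<bullet> dd \<phi> y w) *\<^sub>R \<phi> y"
proof -
  note P = local_paramD[OF \<phi>]
  have sub: "\<phi> ` U \<subseteq> sphere 0 1" using P(3) by blast
  note T = sphere_param_tangent[OF P(1,2) sub y]
  have lin: "linear (dd \<phi> y)" using smooth_on_linear[OF P(2,1) y] .
  define n where "n = dd (\<lambda>z. dd \<phi> z w) y v - dd \<phi> y (christoffel (coord_metric canonical_metric \<phi>) y v w)"
  have pos: "coord_metric canonical_metric \<phi> y u u > 0" if "u \<noteq> 0" for u
  proof -
    have "dd \<phi> y u \<noteq> 0" using that P(4)[OF y] linear_injective_0[OF lin] by blast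
    then show ?thesis by (simp add: coord_metric_def canonical_metric_def)
  qed
  have bil: "bilinear (\<lambda>A B :: 'a. A \<bullet> B)"
    by (simp add: bilinear_def bounded_linear.linear[OF bounded_linear_inner_right] bounded_linear.linear[OF bounded_linear_inner_left])
  have "2 * (dd \<phi> y (christoffel (coord_metric canonical_metric \<phi>) y v w) \<bullet> dd \<phi> y u)
      = 0 + 0 - 0 + 2 * (dd (\<lambda>z. dd \<phi> z w) y v \<bullet> dd \<phi> y u)" for u
    by (rule christoffel_pullback[where h="coord_metric canonical_metric \<phi>" and H="\<lambda>p A B. A \<bullet> B" and DH="\<lambda>C A B. 0", OF P(1) y P(2) _ bil _ _ pos])
       (auto simp: coord_metric_def canonical_metric_def inner_commute)
  then have nu: "n \<bullet> dd \<phi> y u = 0" for u by (simp add: n_def inner_diff_left)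
  have xx: "\<phi> y \<bullet> \<phi> y = 1" using sub y by (metis imageI mem_sphere_0 norm_eq_1 subset_eq)
  have np: "n \<bullet> \<phi> y = - (dd \<phi> y v \<bullet> dd \<phi> y w)"
    using T by (simp add: n_def inner_diff_left)
  have "(n - (n \<bullet> \<phi> y) *\<^sub>R \<phi> y) \<bullet> \<phi> y = 0" using xx by (simp add: inner_diff_left)
  then obtain u where u: "n - (n \<bullet> \<phi> y) *\<^sub>R \<phi> y = dd \<phi> y u"
    using sphere_param_range[OF dim P(1,2) sub y P(4)[OF y]] by blast
  have "dd \<phi> y u \<bullet> dd \<phi> y u = (n - (n \<bullet> \<phi> y) *\<^sub>R \<phi> y) \<bullet> dd \<phi> y u" using u by simp
  also have "\<dots> = 0" using nu[of u] T(1)[of u] by (simp add: inner_diff_left inner_commute[of "\<phi> y"])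
  finally show ?thesis using u np by (simp add: n_def)
qed

text \<open>
  The inverse of stereographic projection from the antipode \<open>- x\<close>, in terms of a linear isometry \<open>L\<close> of the
  model space onto the orthogonal complement of \<open>x\<close>. Its left inverse \<open>p\<close> is smooth on an open subset \<open>N\<close> of the
  ambient space; this is what makes the induced chart of the tangent bundle easy to handle.
\<close>

lemma sphere_chart:
  fixes x :: "'a::euclidean_space"
  assumes dim: "DIM('a) = DIM('c::euclidean_space) + 1" and x: "norm x = 1"
  obtains \<phi> :: "'c::euclidean_space \<Rightarrow> 'a" and p N where "smooth_on UNIV \<phi>" "open N" "smooth_on N p"
    "range \<phi> = sphere 0 1 \<inter> N" "\<And>y. p (\<phi> y) = y" "x \<in> N"
proof -
  have xx: "x \<bullet> x = 1" using x by (simp add: norm_eq_1)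
  have n0: "x \<noteq> 0" using x by auto
  have d: "dim (UNIV :: 'c set) = dim {X. x \<bullet> X = 0}"
    using dim dim_hyperplane[OF n0] by simp
  obtain L :: "'c \<Rightarrow> 'a" where L: "linear L" "range L = {X. x \<bullet> X = 0}" "\<And>y. norm (L y) = norm y"
    using isometries_subspaces[OF subspace_UNIV subspace_hyperplane d] by (metis UNIV_I)
  \<comment> \<open>\<open>K\<close> is the orthogonal projection to the complement of \<open>x\<close>, followed by the inverse of \<open>L\<close>.\<close>
  define K where "K = adjoint L"
  have K: "K z \<bullet> y = z \<bullet> L y" for z y unfolding K_def using adjoint_clauses(2)[OF L(1)] .
  have linK: "linear K" unfolding K_def using adjoint_linear[OF L(1)] .
  have LL: "L y \<bullet> L z = y \<bullet> z" for y z
  proof -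
    have "L (y + z) \<bullet> L (y + z) = (y + z) \<bullet> (y + z)" using L(3) by (metis dot_square_norm)
    moreover have "L v \<bullet> L v = v \<bullet> v" for v using L(3) by (metis dot_square_norm)
    ultimately show ?thesis by (simp add: linear_add[OF L(1)] inner_simps inner_commute)
  qed
  have KL: "K (L y) = y" for y
    by (rule vector_eq_rdot[THEN iffD1, rule_format]) (simp add: K LL)
  have xL: "x \<bullet> L y = 0" for y using L(2) by blast
  have Kx: "K x = 0"
    by (rule vector_eq_rdot[THEN iffD1, rule_format]) (simp add: K xL)
  have LK: "L (K z) = z - (x \<bullet> z) *\<^sub>R x" for z
  proof -
    have "x \<bullet> (z - (x \<bullet> z) *\<^sub>R x) = 0" using xx by (simp add: inner_diff_right)
    then obtain y where y: "z - (x \<bullet> z) *\<^sub>R x = L y" using L(2) by blast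
    then have "K z = y"
      using KL[of y] Kx by (metis diff_zero linear_diff[OF linK] linear_scale[OF linK] scaleR_zero_right)
    then show ?thesis using y by simp
  qed
  define s where "s y = inverse (1 + y \<bullet> y)" for y :: 'c
  define \<phi> where "\<phi> y = (2 * s y) *\<^sub>R (x + L y) + - x" for y
  define N where "N = {z. 1 + x \<bullet> z \<noteq> 0}"
  define p where "p z = inverse (1 + x \<bullet> z) *\<^sub>R K z" for z
  have pos: "1 + y \<bullet> y > 0" for y :: 'c by (intro add_pos_nonneg) auto
  have ne: "1 + y \<bullet> y \<noteq> 0" for y :: 'c using pos[of y] by linarith
  have sp: "s y * (1 + y \<bullet> y) = 1" for y using ne[of y] by (simp add: s_def)
  have bL: "bounded_linear L" and bK: "bounded_linear K" using L(1) linK linear_conv_bounded_linear by blast+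
  have smooth: "smooth_on UNIV \<phi>"
    unfolding smooth_on_def
  proof
    fix k
    have "Ck_on k UNIV (\<lambda>y :: 'c. y \<bullet> y)"
      using Ck_on_bilinear[OF open_UNIV bounded_bilinear_inner] Ck_on_bounded_linear[OF open_UNIV bounded_linear_ident]
      by blast
    then have "Ck_on k UNIV (\<lambda>y :: 'c. 1 + y \<bullet> y)"
      using Ck_on_add[OF open_UNIV Ck_on_const] by blast
    then have "Ck_on k UNIV (\<lambda>y :: 'c. s y)" unfolding s_def
      by (rule Ck_on_inverse[OF open_UNIV ne])
    then have s2: "Ck_on k UNIV (\<lambda>y :: 'c. 2 * s y)"
      by (rule Ck_on_linear_left[OF open_UNIV bounded_linear_mult_right])
    have "Ck_on k UNIV (\<lambda>y. x + L y)"
      using Ck_on_add[OF open_UNIV Ck_on_const Ck_on_bounded_linear[OF open_UNIV bL]] .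
    from Ck_on_bilinear[OF open_UNIV bounded_bilinear_scaleR s2 this]
    show "Ck_on k UNIV \<phi>" unfolding \<phi>_def
      by (rule Ck_on_add[OF open_UNIV _ Ck_on_const])
  qed
  have openN: "open N"
    unfolding N_def by (intro open_Collect_neq continuous_intros)
  have smoothp: "smooth_on N p"
    unfolding smooth_on_def
  proof
    fix k
    have "Ck_on k N (\<lambda>z. 1 + x \<bullet> z)"
      using Ck_on_add[OF openN Ck_on_const Ck_on_bounded_linear[OF openN bounded_linear_inner_right]] .
    then have "Ck_on k N (\<lambda>z. inverse (1 + x \<bullet> z))"
      by (rule Ck_on_inverse[OF openN, rotated]) (simp add: N_def)
    then show "Ck_on k N p" unfolding p_def
      by (rule Ck_on_bilinear[OF openN bounded_bilinear_scaleR _ Ck_on_bounded_linear[OF openN bK]])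
  qed
  have x\<phi>: "1 + x \<bullet> \<phi> y = 2 * s y" for y using xL xx by (simp add: \<phi>_def inner_simps)
  have s0: "s y \<noteq> 0" for y using ne by (simp add: s_def)
  have in_sphere: "norm (\<phi> y) = 1" for y
  proof -
    have "\<phi> y \<bullet> \<phi> y = 4 * s y * (s y * (1 + y \<bullet> y)) - 4 * s y + 1"
      using xL xx LL by (simp add: \<phi>_def inner_simps inner_commute algebra_simps)
    then show ?thesis unfolding sp norm_eq_1 by simp
  qed
  have p\<phi>: "p (\<phi> y) = y" for y
  proof -
    have "K (\<phi> y) = (2 * s y) *\<^sub>R y"
      by (simp add: \<phi>_def linear_add[OF linK] linear_diff[OF linK] linear_scale[OF linK] linear_neg[OF linK] KL Kx)
    then show ?thesis using s0[of y] by (simp add: p_def x\<phi>)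
  qed
  have "\<phi> (p z) = z" if z: "norm z = 1" "z \<in> N" for z
  proof -
    define c where "c = 1 + x \<bullet> z"
    have c: "c \<noteq> 0" using z(2) by (simp add: N_def c_def)
    have zz: "z \<bullet> z = 1" using z(1) by (simp add: norm_eq_1)
    have "K z \<bullet> K z = c * (2 - c)"
      unfolding LL[symmetric] LK using zz xx by (simp add: c_def inner_simps inner_commute algebra_simps)
    then have "1 + p z \<bullet> p z = 1 + inverse c * inverse c * (c * (2 - c))"
      unfolding p_def c_def[symmetric] by simp
    also have "\<dots> = 2 / c" using c by (simp add: field_simps)
    finally have "2 * s (p z) = c" using c by (simp add: s_def)
    then have "\<phi> (p z) = c *\<^sub>R (x + inverse c *\<^sub>R (z - (x \<bullet> z) *\<^sub>R x)) - x"
      unfolding \<phi>_def by (simp add: p_def linear_scale[OF L(1)] LK c_def)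
    also have "\<dots> = c *\<^sub>R x + (z - (x \<bullet> z) *\<^sub>R x) - x" using c by (simp add: scaleR_add_right)
    also have "\<dots> = z" by (simp add: c_def algebra_simps)
    finally show ?thesis .
  qed
  then have "range \<phi> = sphere 0 1 \<inter> N"
    using in_sphere x\<phi> s0 by (auto simp: N_def) (metis rangeI)
  moreover have "x \<in> N" using xx by (simp add: N_def)
  ultimately show thesis using that smooth openN smoothp p\<phi> by blast
qed

text \<open>
  By functoriality of the differential, the differential of \<open>p\<close> is a left inverse of the differential of \<open>\<phi>\<close>.
\<close>

lemma tangent_param_local_param:
  fixes \<phi> :: "'c::euclidean_space \<Rightarrow> 'a::euclidean_space"
  assumes dim: "DIM('a) = DIM('c) + 1"
    and \<phi>: "smooth_on UNIV \<phi>" and N: "open N" and p: "smooth_on N p"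
    and r: "range \<phi> = sphere 0 1 \<inter> N" and p\<phi>: "\<And>y. p (\<phi> y) = y"
  shows "local_param (sphere 0 1) UNIV \<phi>"
    and "local_param (tangent_bundle (sphere 0 1)) UNIV (tangent_param \<phi>)"
proof -
  have \<phi>N: "\<phi> y \<in> N" for y using r by blast
  show 1: "local_param (sphere 0 1) UNIV \<phi>"
    by (rule local_paramI[OF open_UNIV \<phi> r N p\<phi> smooth_on_differentiable[OF N p \<phi>N]])
  have "local_param (tangent_bundle (sphere 0 1)) (UNIV \<times> UNIV) (tangent_param \<phi>)"
  proof (rule local_paramI[where N="N \<times> UNIV" and Q="tangent_param p"])
    show "open (UNIV \<times> UNIV :: ('c \<times> 'c) set)" by (simp add: open_Times)
    show "smooth_on (UNIV \<times> UNIV) (tangent_param \<phi>)" by (rule smooth_on_tangent_param[OF open_UNIV \<phi>])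
    show NU: "open (N \<times> (UNIV :: 'a set))" using N by (simp add: open_Times)
    have sub: "range \<phi> \<subseteq> sphere 0 1" using r by blast
    note P = local_paramD[OF 1]
    have ran: "range (dd \<phi> y) = {X. X \<bullet> \<phi> y = 0}" for y
      using sphere_param_range[OF dim P(1,2) sub UNIV_I P(4)[OF UNIV_I]] .
    show "tangent_param \<phi> ` (UNIV \<times> UNIV) = tangent_bundle (sphere 0 1) \<inter> N \<times> UNIV"
    proof (intro equalityI subsetI)
      fix q assume "q \<in> tangent_param \<phi> ` (UNIV \<times> UNIV)"
      then obtain y v where "q = (\<phi> y, dd \<phi> y v)" by (auto simp: tangent_param_def)
      then show "q \<in> tangent_bundle (sphere 0 1) \<inter> N \<times> UNIV"
        using r sphere_param_tangent(1)[OF P(1,2) sub UNIV_I] P(3)[of y] \<phi>N by (auto simp: tangent_bundle_sphere)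
    next
      fix q assume q: "q \<in> tangent_bundle (sphere 0 1) \<inter> N \<times> UNIV"
      obtain z u where zu: "q = (z, u)" by fastforce
      with q have "z \<in> range \<phi>" "u \<bullet> z = 0" using r by (auto simp: tangent_bundle_sphere)
      then obtain y where y: "z = \<phi> y" by blast
      then obtain v where "u = dd \<phi> y v" using ran[of y] \<open>u \<bullet> z = 0\<close> by blast
      then show "q \<in> tangent_param \<phi> ` (UNIV \<times> UNIV)"
        using y zu by (auto simp: tangent_param_def image_iff)
    qed
    fix q :: "'c \<times> 'c"
    obtain y v where q: "q = (y, v)" by fastforce
    have "dd p (\<phi> y) (dd \<phi> y v) = v"
      by (rule dd_left_inverse[where U=UNIV])
         (auto intro: p\<phi> smooth_on_has_derivative[OF open_UNIV \<phi>] smooth_on_differentiable[OF N p \<phi>N])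
    then show "tangent_param p (tangent_param \<phi> q) = q" by (simp add: tangent_param_def q p\<phi>)
    have "tangent_param \<phi> q \<in> N \<times> UNIV" using \<phi>N by (simp add: q tangent_param_def)
    then show "tangent_param p differentiable at (tangent_param \<phi> q)"
      by (rule smooth_on_differentiable[OF NU smooth_on_tangent_param[OF N p]])
  qed
  then show "local_param (tangent_bundle (sphere 0 1)) UNIV (tangent_param \<phi>)" by simp
qed

lemma dd_tangent_param:
  fixes \<phi> :: "'c::euclidean_space \<Rightarrow> 'a::euclidean_space"
  assumes "open U" "smooth_on U \<phi>" "y \<in> U"
  shows "dd (tangent_param \<phi>) (y, v) (w, \<omega>) = (dd \<phi> y w, dd (\<lambda>z. dd \<phi> z v) y w + dd \<phi> y \<omega>)"
proof -
  have UU: "open (U \<times> (UNIV :: 'c set))" using assms(1) by (simp add: open_Times)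
  have yv: "(y, v) \<in> U \<times> UNIV" using assms(3) by simp
  have f: "(fst has_derivative fst) (at (y, v))" for v :: 'c by (auto intro!: derivative_eq_intros)
  have 1: "((\<lambda>q. f (fst q)) has_derivative (\<lambda>q. dd f y (fst q))) (at (y, v))" if "smooth_on U f"
    for f :: "'c \<Rightarrow> 'a" and v :: 'c
    using has_derivative_compose[OF f] smooth_on_has_derivative[OF assms(1) that assms(3)] by fastforce
  have "((\<lambda>q. dd \<phi> (fst q) (snd q)) has_derivative
     (\<lambda>q. dd (\<lambda>z. dd \<phi> z (snd (y, v))) y (fst q) + dd \<phi> (fst (y, v)) (snd q))) (at (y, v))"
    by (rule has_derivative_moving_linear[where A="\<lambda>q. dd \<phi> (fst q)"
         and A'="\<lambda>e q. dd (\<lambda>z. dd \<phi> z e) y (fst q)", OF UU yv _ 1[OF smooth_on_dd[OF assms(2)]]])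
       (auto intro!: smooth_on_linear[OF assms(2,1)] derivative_eq_intros)
  from has_derivative_Pair[OF 1[OF assms(2)] this]
  have "((\<lambda>q. (\<phi> (fst q), dd \<phi> (fst q) (snd q))) has_derivative
     (\<lambda>q. (dd \<phi> y (fst q), dd (\<lambda>z. dd \<phi> z v) y (fst q) + dd \<phi> y (snd q)))) (at (y, v))" by simp
  moreover have "(\<lambda>q. (\<phi> (fst q), dd \<phi> (fst q) (snd q))) = tangent_param \<phi>"
    by (auto simp: tangent_param_def)
  ultimately show ?thesis using dd_eq by fastforce
qed

text \<open>
  In the chart the lift has second component \<open>D\<^sup>2\<phi>(w, v) - d\<phi>(\<Gamma>(w, v))\<close>, which is purely normal.
\<close>

lemma horizontal_lift_sphere:
  fixes x :: "'a::euclidean_space"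
  assumes dim: "DIM('a) = DIM('c::euclidean_space) + 1"
    and x: "norm x = 1" and u: "u \<bullet> x = 0" and X: "X \<bullet> x = 0"
  shows "horizontal_lift TYPE('c) (sphere 0 1) canonical_metric x u X (X, - (X \<bullet> u) *\<^sub>R x)"
proof -
  obtain \<phi> :: "'c \<Rightarrow> 'a" and p N where c: "smooth_on UNIV \<phi>" "open N" "smooth_on N p"
    "range \<phi> = sphere 0 1 \<inter> N" "\<And>y. p (\<phi> y) = y" "x \<in> N"
    by (rule sphere_chart[OF dim x]) (rule that; assumption)
  have P: "local_param (sphere 0 1) UNIV \<phi>" by (rule tangent_param_local_param(1)[OF dim c(1-5)])
  have "x \<in> range \<phi>" using c(4,6) x by simp
  then obtain y where y: "x = \<phi> y" by blast
  have sub: "range \<phi> \<subseteq> sphere 0 1" using c(4) by blast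
  have ran: "range (dd \<phi> y) = {X. X \<bullet> \<phi> y = 0}"
    using sphere_param_range[OF dim open_UNIV c(1) sub UNIV_I local_paramD(4)[OF P UNIV_I]] .
  obtain v where v: "u = dd \<phi> y v" using ran u y by blast
  obtain w where w: "X = dd \<phi> y w" using ran X y by blast
  have lin: "linear (dd \<phi> y)" using smooth_on_linear[OF c(1) open_UNIV UNIV_I] .
  have "dd (tangent_param \<phi>) (y, v) (w, - christoffel (coord_metric canonical_metric \<phi>) y w v)
      = (X, - (X \<bullet> u) *\<^sub>R x)"
    using sphere_christoffel[OF dim P UNIV_I, of v y w] unfolding dd_tangent_param[OF open_UNIV c(1) UNIV_I]
    by (simp add: v w y linear_neg[OF lin])
  then show ?thesis unfolding horizontal_lift_def using P y v w by (metis UNIV_I)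
qed

section \<open>Killing fields of the sphere are linear\<close>

text \<open>
  For \<open>v = w\<close> the Lie derivative of the metric, in the coordinates \<open>\<phi>\<close>, is twice the inner product of the
  derivative of \<open>V\<close> along \<open>v\<close> with \<open>d\<phi> v\<close>. The coordinate field \<open>\<zeta>\<close> of \<open>V\<close> is differentiable because it is
  \<open>dp(V)\<close> for the smooth left inverse \<open>p\<close> of the chart.
\<close>

lemma killing_derivative_skew:
  fixes \<phi> :: "'c::euclidean_space \<Rightarrow> 'a::euclidean_space"
  assumes dim: "DIM('a) = DIM('c) + 1"
    and \<phi>: "smooth_on UNIV \<phi>" and N: "open N" and p: "smooth_on N p"
    and r: "range \<phi> = sphere 0 1 \<inter> N" and p\<phi>: "\<And>y. p (\<phi> y) = y"
    and V: "killing_field TYPE('c) (sphere 0 1) canonical_metric V"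
  shows "(\<lambda>z. V (\<phi> z)) differentiable at y" and "dd (\<lambda>z. V (\<phi> z)) y v \<bullet> dd \<phi> y v = 0"
proof -
  have P: "local_param (sphere 0 1) UNIV \<phi>" by (rule tangent_param_local_param(1)[OF dim \<phi> N p r p\<phi>])
  have sub: "range \<phi> \<subseteq> sphere 0 1" using r by blast
  have \<phi>N: "\<phi> y \<in> N" for y using r by blast
  have lin: "linear (dd \<phi> y)" for y using smooth_on_linear[OF \<phi> open_UNIV UNIV_I] .
  have dpd: "dd p (\<phi> y) (dd \<phi> y v) = v" for y v
    by (rule dd_left_inverse[where U=UNIV])
       (auto intro: p\<phi> smooth_on_has_derivative[OF open_UNIV \<phi>] smooth_on_differentiable[OF N p \<phi>N])
  have vf: "vector_field TYPE('c) (sphere 0 1) V" using V by (simp add: killing_field_def)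
  have Vs: "smooth_on UNIV (\<lambda>z. V (\<phi> z))"
    using vf P unfolding vector_field_def smooth_map_def by blast
  have Vt: "V (\<phi> y) \<bullet> \<phi> y = 0" for y
  proof -
    have "\<phi> y \<in> sphere 0 1" using sub by blast
    then have "V (\<phi> y) \<in> tangent_space (sphere 0 1) (\<phi> y)" using vf unfolding vector_field_def by blast
    then show ?thesis using tangent_space_sphere[OF \<open>\<phi> y \<in> sphere 0 1\<close>] by simp
  qed
  define \<zeta> where "\<zeta> = coord_field V \<phi>"
  have ran: "range (dd \<phi> y) = {X. X \<bullet> \<phi> y = 0}" for y
    using sphere_param_range[OF dim open_UNIV \<phi> sub UNIV_I local_paramD(4)[OF P UNIV_I]] .
  have \<zeta>: "dd \<phi> y (\<zeta> y) = V (\<phi> y)" for y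
  proof -
    obtain v where v: "V (\<phi> y) = dd \<phi> y v" using ran[of y] Vt[of y] by blast
    have "\<zeta> y = v" unfolding \<zeta>_def coord_field_def v
      by (rule the_equality) (use dpd in metis)+
    then show ?thesis using v by simp
  qed
  have \<zeta>p: "\<zeta> y = dd p (\<phi> y) (V (\<phi> y))" for y using dpd[of y "\<zeta> y"] \<zeta>[of y] by simp
  have V': "((\<lambda>z. V (\<phi> z)) has_derivative dd (\<lambda>z. V (\<phi> z)) y) (at y)" for y
    using smooth_on_has_derivative[OF open_UNIV Vs UNIV_I] .
  then show "(\<lambda>z. V (\<phi> z)) differentiable at y" using Derivative.differentiableI by blast
  have \<phi>': "(\<phi> has_derivative dd \<phi> y) (at y)" using smooth_on_has_derivative[OF open_UNIV \<phi> UNIV_I] .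
  have "((\<lambda>z. dd p (\<phi> z) (V (\<phi> z))) has_derivative
     (\<lambda>v. dd (\<lambda>x. dd p x (V (\<phi> y))) (\<phi> y) (dd \<phi> y v) + dd p (\<phi> y) (dd (\<lambda>z. V (\<phi> z)) y v))) (at y)"
    by (rule has_derivative_moving_linear[where A="\<lambda>z. dd p (\<phi> z)"
          and A'="\<lambda>e v. dd (\<lambda>x. dd p x e) (\<phi> y) (dd \<phi> y v)", OF open_UNIV UNIV_I _ _ V'])
       (use smooth_on_linear[OF p N \<phi>N]
          has_derivative_compose[OF \<phi>' smooth_on_has_derivative[OF N smooth_on_dd[OF p] \<phi>N]] in auto)
  then have "\<zeta> differentiable at y" unfolding \<zeta>p[abs_def, symmetric] by (rule Derivative.differentiableI)
  then have \<zeta>': "(\<zeta> has_derivative dd \<zeta> y) (at y)" by (rule dd_works)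
  have \<phi>2: "((\<lambda>z. dd \<phi> z e) has_derivative dd (\<lambda>z. dd \<phi> z e) y) (at y)" for e
    using smooth_on_has_derivative[OF open_UNIV smooth_on_dd[OF \<phi>] UNIV_I] .
  have "((\<lambda>z. dd \<phi> z (\<zeta> z)) has_derivative
     (\<lambda>v. dd (\<lambda>z. dd \<phi> z (\<zeta> y)) y v + dd \<phi> y (dd \<zeta> y v))) (at y)"
    by (rule has_derivative_moving_linear[where A="dd \<phi>" and A'="\<lambda>e. dd (\<lambda>z. dd \<phi> z e) y",
         OF open_UNIV UNIV_I lin \<phi>2 \<zeta>'])
  then have Vv: "dd (\<lambda>z. V (\<phi> z)) y v = dd (\<lambda>z. dd \<phi> z (\<zeta> y)) y v + dd \<phi> y (dd \<zeta> y v)"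
    unfolding \<zeta> by (rule dd_eq)
  have "((\<lambda>z. dd \<phi> z v \<bullet> dd \<phi> z v) has_derivative
      (\<lambda>w. dd \<phi> y v \<bullet> dd (\<lambda>z. dd \<phi> z v) y w + dd (\<lambda>z. dd \<phi> z v) y w \<bullet> dd \<phi> y v)) (at y)"
    by (intro has_derivative_inner \<phi>2)
  from dd_eq[OF this, of "\<zeta> y"]
  have g': "dd (\<lambda>z. coord_metric canonical_metric \<phi> z v v) y (\<zeta> y)
     = 2 * (dd (\<lambda>z. dd \<phi> z v) y (\<zeta> y) \<bullet> dd \<phi> y v)"
    by (simp add: coord_metric_def canonical_metric_def inner_commute)
  have "lie_metric \<zeta> (coord_metric canonical_metric \<phi>) y v v = 0"
    using V P unfolding killing_field_def \<zeta>_def by blast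
  then have "2 * (dd (\<lambda>z. dd \<phi> z v) y (\<zeta> y) \<bullet> dd \<phi> y v) + 2 * (dd \<phi> y (dd \<zeta> y v) \<bullet> dd \<phi> y v) = 0"
    unfolding lie_metric_def g' by (simp add: coord_metric_def canonical_metric_def inner_commute)
  moreover have "dd (\<lambda>z. dd \<phi> z v) y (\<zeta> y) = dd (\<lambda>z. dd \<phi> z (\<zeta> y)) y v"
    by (rule smooth_on_second_symmetric[OF open_UNIV \<phi> UNIV_I])
  ultimately show "dd (\<lambda>z. V (\<phi> z)) y v \<bullet> dd \<phi> y v = 0"
    unfolding Vv by (simp add: inner_add_left)
qed

text \<open>
  The chart-free form of \<open>killing_derivative_skew\<close>.
\<close>

lemma killing_along_curve:
  fixes V :: "'a::euclidean_space \<Rightarrow> 'a"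
  assumes dim: "DIM('a) = DIM('c::euclidean_space) + 1"
    and V: "killing_field TYPE('c) (sphere 0 1) canonical_metric V"
    and \<gamma>: "\<And>s. \<gamma> s \<in> sphere 0 1" and \<gamma>': "(\<gamma> has_vector_derivative X) (at t)"
  obtains Y where "((\<lambda>s. V (\<gamma> s)) has_vector_derivative Y) (at t)" "Y \<bullet> X = 0"
proof -
  have "norm (\<gamma> t) = 1" using \<gamma>[of t] by simp
  obtain \<phi> :: "'c \<Rightarrow> 'a" and p N where c: "smooth_on UNIV \<phi>" "open N" "smooth_on N p"
    "range \<phi> = sphere 0 1 \<inter> N" "\<And>y. p (\<phi> y) = y" "\<gamma> t \<in> N"
    by (rule sphere_chart[OF dim \<open>norm (\<gamma> t) = 1\<close>]) (rule that; assumption)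
  note K = killing_derivative_skew[OF dim c(1-5) V]
  have \<phi>p: "\<phi> (p z) = z" if "z \<in> sphere 0 1 \<inter> N" for z
    using that c(5) unfolding c(4)[symmetric] by auto
  have "isCont \<gamma> t" using \<gamma>' has_vector_derivative_continuous by blast
  then have ev: "\<forall>\<^sub>F s in at t. \<gamma> s \<in> N"
    using c(2,6) by (simp add: isCont_def topological_tendstoD)
  define y where "y = p (\<gamma> t)"
  have y: "\<phi> y = \<gamma> t" unfolding y_def using \<phi>p \<gamma> c(6) by blast
  have g': "(\<gamma> has_derivative (\<lambda>s. s *\<^sub>R X)) (at t)" using \<gamma>' by (simp add: has_vector_derivative_def)
  define v where "v s = dd p (\<gamma> t) (s *\<^sub>R X)" for s :: real
  have p\<gamma>: "((\<lambda>s. p (\<gamma> s)) has_derivative v) (at t)"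
    unfolding v_def using has_derivative_compose[OF g' smooth_on_has_derivative[OF c(2,3,6)]] .
  have "linear (dd p (\<gamma> t))" using smooth_on_linear[OF c(3,2,6)] .
  then have v1: "v s = s *\<^sub>R v 1" for s by (simp add: v_def linear_scale)
  have push: "((\<lambda>s. f (\<gamma> s)) has_derivative (\<lambda>s. s *\<^sub>R dd (\<lambda>z. f (\<phi> z)) y (v 1))) (at t)"
    if f: "(\<lambda>z. f (\<phi> z)) differentiable at y" for f :: "'a \<Rightarrow> 'a"
  proof -
    have "((\<lambda>s. f (\<phi> (p (\<gamma> s)))) has_derivative (\<lambda>s. dd (\<lambda>z. f (\<phi> z)) y (v s))) (at t)"
      using has_derivative_compose[OF p\<gamma>] dd_works[OF f] unfolding y_def by blast
    then have push_v: "((\<lambda>s. f (\<gamma> s)) has_derivative (\<lambda>s. dd (\<lambda>z. f (\<phi> z)) y (v s))) (at t)"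
    proof (rule has_derivative_transform_eventually)
      show "\<forall>\<^sub>F s in at t. f (\<phi> (p (\<gamma> s))) = f (\<gamma> s)"
        using ev by eventually_elim (use \<phi>p \<gamma> in auto)
    qed (use \<phi>p \<gamma> c(6) in auto)
    show ?thesis
    proof (rule has_derivative_eq_rhs[OF push_v], rule ext)
      fix s show "dd (\<lambda>z. f (\<phi> z)) y (v s) = s *\<^sub>R dd (\<lambda>z. f (\<phi> z)) y (v 1)"
        using v1[of s] linear_scale[OF linear_frechet_derivative[OF f]] by metis
    qed
  qed
  have "((\<lambda>s. \<gamma> s) has_derivative (\<lambda>s. s *\<^sub>R dd \<phi> y (v 1))) (at t)"
    using push[of "\<lambda>x. x"] smooth_on_differentiable[OF open_UNIV c(1) UNIV_I] by simp
  then have "(\<lambda>s. s *\<^sub>R dd \<phi> y (v 1)) = (\<lambda>s. s *\<^sub>R X)" using g' has_derivative_unique by blast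
  then have "dd \<phi> y (v 1) = X" by (metis scaleR_one)
  then have "dd (\<lambda>z. V (\<phi> z)) y (v 1) \<bullet> X = 0" using K(2)[of y "v 1"] by simp
  moreover have "((\<lambda>s. V (\<gamma> s)) has_vector_derivative dd (\<lambda>z. V (\<phi> z)) y (v 1)) (at t)"
    using push[OF K(1)] by (simp add: has_vector_derivative_def)
  ultimately show thesis using that by blast
qed

lemma killing_tangent:
  assumes "killing_field TYPE('c::euclidean_space) (sphere 0 1) canonical_metric V" "norm x = 1"
  shows "V x \<bullet> x = 0"
  using assms tangent_space_sphere[of x] unfolding killing_field_def vector_field_def by auto

text \<open>
  Clairaut's relation. If \<open>\<gamma>\<close> is the great circle from \<open>x\<close> in the unit direction \<open>q\<close> and \<open>\<gamma> \<theta> = y\<close>, then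
  \<open>V(\<gamma>) \<bullet> \<gamma>'\<close> has derivative \<open>V(\<gamma>)' \<bullet> \<gamma>' - V(\<gamma>) \<bullet> \<gamma> = 0\<close>, so that \<open>V x \<bullet> y = sin \<theta> (V x \<bullet> q)\<close> and
  \<open>x \<bullet> V y = - sin \<theta> (V y \<bullet> \<gamma>' \<theta>)\<close> add up to zero.
\<close>

lemma killing_skew:
  fixes V :: "'a::euclidean_space \<Rightarrow> 'a"
  assumes dim: "DIM('a) = DIM('c::euclidean_space) + 1"
    and V: "killing_field TYPE('c) (sphere 0 1) canonical_metric V"
    and x: "norm x = 1" and y: "norm y = 1"
  shows "V x \<bullet> y + x \<bullet> V y = 0"
proof -
  note tan = killing_tangent[OF V]
  have xx: "x \<bullet> x = 1" and yy: "y \<bullet> y = 1" using x y by (simp_all add: norm_eq_1)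
  define c where "c = x \<bullet> y"
  have rem: "(y - c *\<^sub>R x) \<bullet> (y - c *\<^sub>R x) = 1 - c\<^sup>2"
    using xx yy by (simp add: c_def inner_simps inner_commute power2_eq_square)
  show ?thesis
  proof (cases "y - c *\<^sub>R x = 0")
    \<comment> \<open>Here \<open>y = x\<close> or \<open>y = - x\<close>, and no great circle through both is singled out.\<close>
    case True
    then have "y = c *\<^sub>R x" by simp
    moreover from rem True have "c\<^sup>2 = 1" by simp
    then have "c = 1 \<or> c = -1" by (simp add: power2_eq_1_iff)
    ultimately show ?thesis using tan[OF x] tan[OF y] by (auto simp: inner_commute)
  next
    case False
    then have "1 - c\<^sup>2 > 0" using rem by (metis inner_gt_zero_iff)
    then have c: "\<bar>c\<bar> \<le> 1" using abs_square_less_1[of c] by simp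
    define \<theta> where "\<theta> = arccos c"
    define s where "s = sqrt (1 - c\<^sup>2)"
    have cs: "cos \<theta> = c" "sin \<theta> = s" using c by (auto simp: \<theta>_def s_def sin_arccos_abs)
    have s: "s > 0" "s * s = 1 - c\<^sup>2" using \<open>1 - c\<^sup>2 > 0\<close> by (auto simp: s_def)
    define q where "q = (1 / s) *\<^sub>R (y - c *\<^sub>R x)"
    have "q \<bullet> q = (1 / s) * ((1 / s) * (s * s))"
      unfolding s(2) rem[symmetric] by (simp only: q_def inner_scaleR_left inner_scaleR_right)
    then have qq: "q \<bullet> q = 1" using s(1) by simp
    have xq: "x \<bullet> q = 0" using xx by (simp add: q_def c_def inner_simps)
    have yq: "y = c *\<^sub>R x + s *\<^sub>R q" using s by (simp add: q_def)
    define \<gamma> where "\<gamma> t = cos t *\<^sub>R x + sin t *\<^sub>R q" for t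
    define \<gamma>1 where "\<gamma>1 t = - sin t *\<^sub>R x + cos t *\<^sub>R q" for t
    have \<gamma>': "(\<gamma> has_vector_derivative \<gamma>1 t) (at t)" for t
      unfolding \<gamma>_def \<gamma>1_def by (auto intro!: derivative_eq_intros)
    have \<gamma>1': "(\<gamma>1 has_vector_derivative - \<gamma> t) (at t)" for t
      unfolding \<gamma>_def \<gamma>1_def by (auto intro!: derivative_eq_intros)
    have "\<gamma> t \<bullet> \<gamma> t = 1" for t
      using xx qq xq sin_cos_squared_add[of t]
      by (simp add: \<gamma>_def inner_simps inner_commute power2_eq_square add.commute)
    then have \<gamma>S: "\<gamma> t \<in> sphere 0 1" for t by (simp add: norm_eq_1)
    have "DERIV (\<lambda>t. V (\<gamma> t) \<bullet> \<gamma>1 t) t :> 0" for t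
    proof -
      obtain Y where Y: "((\<lambda>s. V (\<gamma> s)) has_vector_derivative Y) (at t)" "Y \<bullet> \<gamma>1 t = 0"
        using killing_along_curve[OF dim V \<gamma>S \<gamma>'] .
      have "((\<lambda>t. V (\<gamma> t) \<bullet> \<gamma>1 t) has_derivative
          (\<lambda>h. V (\<gamma> t) \<bullet> (h *\<^sub>R - \<gamma> t) + (h *\<^sub>R Y) \<bullet> \<gamma>1 t)) (at t)"
        using Y(1) \<gamma>1' unfolding has_vector_derivative_def by (intro has_derivative_inner)
      moreover have "V (\<gamma> t) \<bullet> \<gamma> t = 0" using tan \<gamma>S[of t] by simp
      ultimately show ?thesis using Y(2) by (simp add: has_field_derivative_def lambda_zero)
    qed
    then have "V (\<gamma> \<theta>) \<bullet> \<gamma>1 \<theta> = V (\<gamma> 0) \<bullet> \<gamma>1 0" using DERIV_isconst_all by blast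
    moreover have "\<gamma> \<theta> = y" "\<gamma> 0 = x" "\<gamma>1 0 = q" using yq by (simp_all add: \<gamma>_def \<gamma>1_def cs)
    ultimately have G: "V y \<bullet> \<gamma>1 \<theta> = V x \<bullet> q" by simp
    have "c *\<^sub>R y - s *\<^sub>R \<gamma>1 \<theta> = (c\<^sup>2 + s * s) *\<^sub>R x"
      unfolding \<gamma>1_def cs by (subst yq) (simp add: algebra_simps power2_eq_square)
    then have "x = c *\<^sub>R y - s *\<^sub>R \<gamma>1 \<theta>" using s by simp
    then have "V y \<bullet> x = V y \<bullet> (c *\<^sub>R y - s *\<^sub>R \<gamma>1 \<theta>)" by simp
    also have "\<dots> = - s * (V x \<bullet> q)" using tan[OF y] G by (simp add: inner_diff_right)
    finally have "x \<bullet> V y = - s * (V x \<bullet> q)" by (simp add: inner_commute)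
    moreover have "V x \<bullet> y = s * (V x \<bullet> q)"
      by (subst yq) (simp add: inner_add_right tan[OF x])
    ultimately show ?thesis by simp
  qed
qed

text \<open>
  The relation \<open>killing_skew\<close> expresses the components of \<open>\<xi> x\<close> linearly in \<open>x\<close>, as \<open>\<xi> x \<bullet> e = - (x \<bullet> \<xi> e)\<close>.
\<close>

lemma hopf_field_linear:
  fixes \<xi> :: "'a::euclidean_space \<Rightarrow> 'a"
  assumes dim: "DIM('a) = DIM('c::euclidean_space) + 1" and \<xi>: "hopf_field TYPE('c) \<xi>"
  obtains J where "linear J" "\<And>x. norm x = 1 \<Longrightarrow> \<xi> x = J x"
    "\<And>x y. J x \<bullet> y = - (x \<bullet> J y)" "\<And>x y. J x \<bullet> J y = x \<bullet> y"
proof -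
  have kill: "killing_field TYPE('c) (sphere 0 1) canonical_metric \<xi>"
    and unit: "\<And>x. norm x = 1 \<Longrightarrow> norm (\<xi> x) = 1"
    using \<xi> by (auto simp: hopf_field_def canonical_metric_def norm_eq_1)
  note skew = killing_skew[OF dim kill]
  define J where "J x = (\<Sum>e\<in>Basis. - (x \<bullet> \<xi> e) *\<^sub>R e)" for x
  have lin: "linear J"
    by (rule linearI) (simp_all add: J_def inner_add_left scaleR_sum_right sum_subtractf sum_negf scaleR_left_distrib algebra_simps sum.distrib)
  have J: "\<xi> x = J x" if "norm x = 1" for x
  proof -
    have "\<xi> x = (\<Sum>e\<in>Basis. (\<xi> x \<bullet> e) *\<^sub>R e)" by (simp add: euclidean_representation)
    also have "\<dots> = J x"
      unfolding J_def
    proof (rule sum.cong[OF refl])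
      fix e :: 'a assume "e \<in> Basis"
      then have "\<xi> x \<bullet> e = - (x \<bullet> \<xi> e)" using skew[OF that, of e] by (simp add: eq_neg_iff_add_eq_0)
      then show "(\<xi> x \<bullet> e) *\<^sub>R e = - (x \<bullet> \<xi> e) *\<^sub>R e" by simp
    qed
    finally show ?thesis .
  qed
  \<comment> \<open>Both remaining identities are known on unit vectors and extend by homogeneity.\<close>
  have unitize: "\<exists>y. norm y = 1 \<and> x = norm x *\<^sub>R y" if "x \<noteq> 0" for x :: 'a
    using that by (intro exI[of _ "sgn x"]) (simp add: norm_sgn sgn_div_norm)
  have Jskew: "J x \<bullet> y = - (x \<bullet> J y)" for x y
  proof (cases "x = 0 \<or> y = 0")
    case True
    then show ?thesis using linear_0[OF lin] by auto
  next
    case False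
    then obtain a b where ab: "norm a = 1" "x = norm x *\<^sub>R a" "norm b = 1" "y = norm y *\<^sub>R b"
      using unitize by metis
    have 1: "J a \<bullet> b = - (a \<bullet> J b)" using skew[OF ab(1,3)] J ab(1,3) by simp
    have 2: "J x = norm x *\<^sub>R J a" "J y = norm y *\<^sub>R J b"
      using linear_scale[OF lin] ab(2,4) by metis+
    have "J x \<bullet> y = norm x * norm y * (J a \<bullet> b)" unfolding 2 by (subst ab(4)) simp
    moreover have "x \<bullet> J y = norm x * norm y * (a \<bullet> J b)" unfolding 2 by (subst ab(2)) simp
    ultimately show ?thesis using 1 by simp
  qed
  have Jnorm: "norm (J x) = norm x" for x
  proof (cases "x = 0")
    case True then show ?thesis using linear_0[OF lin] by simp
  next
    case False
    then obtain a where a: "norm a = 1" "x = norm x *\<^sub>R a" using unitize by blast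
    have "J x = norm x *\<^sub>R J a" using linear_scale[OF lin] a(2) by metis
    then show ?thesis using unit[OF a(1)] J[OF a(1)] by simp
  qed
  have "J x \<bullet> J y = x \<bullet> y" for x y
  proof -
    have "J v \<bullet> J v = v \<bullet> v" for v using Jnorm by (metis dot_square_norm)
    from this[of "x + y"] this[of x] this[of y] show ?thesis
      by (simp add: linear_add[OF lin] inner_simps inner_commute)
  qed
  with lin J Jskew show thesis using that by blast
qed

section \<open>The ambient form of a natural metric\<close>

text \<open>
  The extension of a natural metric from the tangent spaces of the tangent bundle to the ambient space. On
  tangent vectors at \<open>(x, u)\<close> the vertical part of \<open>A\<close> is \<open>snd A + (fst A \<bullet> u) x\<close>; the products of the normal
  components cancel to \<open>- (fst A \<bullet> u) (fst B \<bullet> u)\<close>, which accounts for the term \<open>- \<alpha>\<^sub>1\<close> in the second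
  coefficient and makes the formula independent of \<open>x\<close>.
\<close>

definition natural_form :: "(nat \<Rightarrow> real \<Rightarrow> real) \<Rightarrow> (nat \<Rightarrow> real \<Rightarrow> real) \<Rightarrow>
    'a::euclidean_space \<Rightarrow> 'a \<times> 'a \<Rightarrow> 'a \<times> 'a \<Rightarrow> real" where
  "natural_form \<alpha> \<beta> u A B =
     (\<alpha> 1 (u \<bullet> u) + \<alpha> 3 (u \<bullet> u)) * (fst A \<bullet> fst B)
     + (\<beta> 1 (u \<bullet> u) + \<beta> 3 (u \<bullet> u) - \<alpha> 1 (u \<bullet> u)) * ((fst A \<bullet> u) * (fst B \<bullet> u))
     + \<alpha> 2 (u \<bullet> u) * (fst A \<bullet> snd B + fst B \<bullet> snd A)
     + \<beta> 2 (u \<bullet> u) * ((fst A \<bullet> u) * (snd B \<bullet> u) + (fst B \<bullet> u) * (snd A \<bullet> u))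
     + \<alpha> 1 (u \<bullet> u) * (snd A \<bullet> snd B)
     + \<beta> 1 (u \<bullet> u) * ((snd A \<bullet> u) * (snd B \<bullet> u))"

lemma natural_form_sym: "natural_form \<alpha> \<beta> u A B = natural_form \<alpha> \<beta> u B A"
  by (simp add: natural_form_def inner_commute mult.commute add.commute)

lemma natural_form_bilinear: "bilinear (natural_form \<alpha> \<beta> u)"
proof -
  have "linear (\<lambda>A. natural_form \<alpha> \<beta> u A B)" for B
    by (rule linearI) (simp_all add: natural_form_def inner_simps algebra_simps)
  moreover from this have "linear (natural_form \<alpha> \<beta> u B)" for B
    using natural_form_sym[of \<alpha> \<beta> u B] by presburger
  ultimately show ?thesis by (simp add: bilinear_def)
qed

text \<open>
  Decompose both tangent vectors into their horizontal and vertical parts.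
\<close>

lemma natural_metric_eq_form:
  fixes x u :: "'a::euclidean_space"
  assumes dim: "DIM('a) = DIM('c::euclidean_space) + 1"
    and nat: "natural_metric TYPE('c) (sphere 0 1) canonical_metric \<alpha> \<beta> G"
    and riem: "riemannian_metric TYPE('c \<times> 'c) (tangent_bundle (sphere 0 1)) G"
    and x: "norm x = 1" and u: "u \<bullet> x = 0"
    and A: "fst A \<bullet> x = 0" "snd A \<bullet> x + fst A \<bullet> u = 0"
    and B: "fst B \<bullet> x = 0" "snd B \<bullet> x + fst B \<bullet> u = 0"
  shows "G (x, u) A B = natural_form \<alpha> \<beta> u A B"
proof -
  let ?T = "tangent_space (tangent_bundle (sphere 0 1)) (x, u)"
  have xx: "x \<bullet> x = 1" using x by (simp add: norm_eq_1)
  have xu: "(x, u) \<in> tangent_bundle (sphere 0 1)" using x u by (simp add: tangent_bundle_sphere)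
  have lin: "G (x, u) (a *\<^sub>R X + b *\<^sub>R Y) Z = a * G (x, u) X Z + b * G (x, u) Y Z"
    if "X \<in> ?T" "Y \<in> ?T" "Z \<in> ?T" for X Y Z a b
    using riem xu that unfolding riemannian_metric_def by blast
  have sym: "G (x, u) X Y = G (x, u) Y X" if "X \<in> ?T" "Y \<in> ?T" for X Y
    using riem xu that unfolding riemannian_metric_def by blast
  have add: "G (x, u) (X + Y) Z = G (x, u) X Z + G (x, u) Y Z"
    if "X \<in> ?T" "Y \<in> ?T" "Z \<in> ?T" for X Y Z
    using lin[OF that, of 1 1] by simp
  define h where "h X = (X, - (X \<bullet> u) *\<^sub>R x)" for X
  define K where "K A = snd A + (fst A \<bullet> u) *\<^sub>R x" for A :: "'a \<times> 'a"
  have hT: "h X \<in> ?T" if "X \<bullet> x = 0" for X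
    unfolding h_def by (rule tangent_space_tangent_bundle_sphereI[OF x u that]) (simp add: xx)
  have vT: "vertical_lift X \<in> ?T" if "X \<bullet> x = 0" for X
    unfolding vertical_lift_def by (rule tangent_space_tangent_bundle_sphereI[OF x u]) (simp_all add: that)
  have dec: "A = h (fst A) + vertical_lift (K A)" for A
    by (simp add: h_def vertical_lift_def K_def prod_eq_iff)
  have K0: "K A \<bullet> x = 0" if "snd A \<bullet> x + fst A \<bullet> u = 0" for A
    using that xx by (simp add: K_def inner_add_left)
  have hl: "horizontal_lift TYPE('c) (sphere 0 1) canonical_metric x u X (h X)" if "X \<bullet> x = 0" for X
    unfolding h_def by (rule horizontal_lift_sphere[OF dim x u that])
  have xS: "x \<in> sphere 0 1" using x by simp
  have ts: "Z \<in> tangent_space (sphere 0 1) x \<longleftrightarrow> Z \<bullet> x = 0" for Z using tangent_space_sphere[OF xS] by simp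
  have N:
    "G (x, u) (h X) (h Y) = (\<alpha> 1 (u \<bullet> u) + \<alpha> 3 (u \<bullet> u)) * (X \<bullet> Y) + (\<beta> 1 (u \<bullet> u) + \<beta> 3 (u \<bullet> u)) * (X \<bullet> u) * (Y \<bullet> u)"
    "G (x, u) (h X) (vertical_lift Y) = \<alpha> 2 (u \<bullet> u) * (X \<bullet> Y) + \<beta> 2 (u \<bullet> u) * (X \<bullet> u) * (Y \<bullet> u)"
    "G (x, u) (vertical_lift X) (h Y) = \<alpha> 2 (u \<bullet> u) * (X \<bullet> Y) + \<beta> 2 (u \<bullet> u) * (X \<bullet> u) * (Y \<bullet> u)"
    "G (x, u) (vertical_lift X) (vertical_lift Y) = \<alpha> 1 (u \<bullet> u) * (X \<bullet> Y) + \<beta> 1 (u \<bullet> u) * (X \<bullet> u) * (Y \<bullet> u)"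
    if X: "X \<bullet> x = 0" and Y: "Y \<bullet> x = 0" for X Y
  proof -
    from nat have "\<forall>x\<in>sphere 0 1. \<forall>u\<in>tangent_space (sphere 0 1) x. \<forall>X\<in>tangent_space (sphere 0 1) x.
      \<forall>Y\<in>tangent_space (sphere 0 1) x. \<forall>Xh Yh.
        horizontal_lift TYPE('c) (sphere 0 1) canonical_metric x u X Xh \<longrightarrow>
        horizontal_lift TYPE('c) (sphere 0 1) canonical_metric x u Y Yh \<longrightarrow>
        (let r2 = canonical_metric x u u; Xv = vertical_lift X; Yv = vertical_lift Y in
           G (x, u) Xh Yh = (\<alpha> 1 r2 + \<alpha> 3 r2) * canonical_metric x X Y + (\<beta> 1 r2 + \<beta> 3 r2) * canonical_metric x X u * canonical_metric x Y u \<and>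
           G (x, u) Xh Yv = \<alpha> 2 r2 * canonical_metric x X Y + \<beta> 2 r2 * canonical_metric x X u * canonical_metric x Y u \<and>
           G (x, u) Xv Yh = \<alpha> 2 r2 * canonical_metric x X Y + \<beta> 2 r2 * canonical_metric x X u * canonical_metric x Y u \<and>
           G (x, u) Xv Yv = \<alpha> 1 r2 * canonical_metric x X Y + \<beta> 1 r2 * canonical_metric x X u * canonical_metric x Y u)"
      unfolding natural_metric_def by (elim conjE)
    from this[rule_format, OF xS, of u X Y "h X" "h Y"]
    show
    "G (x, u) (h X) (h Y) = (\<alpha> 1 (u \<bullet> u) + \<alpha> 3 (u \<bullet> u)) * (X \<bullet> Y) + (\<beta> 1 (u \<bullet> u) + \<beta> 3 (u \<bullet> u)) * (X \<bullet> u) * (Y \<bullet> u)"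
    "G (x, u) (h X) (vertical_lift Y) = \<alpha> 2 (u \<bullet> u) * (X \<bullet> Y) + \<beta> 2 (u \<bullet> u) * (X \<bullet> u) * (Y \<bullet> u)"
    "G (x, u) (vertical_lift X) (h Y) = \<alpha> 2 (u \<bullet> u) * (X \<bullet> Y) + \<beta> 2 (u \<bullet> u) * (X \<bullet> u) * (Y \<bullet> u)"
    "G (x, u) (vertical_lift X) (vertical_lift Y) = \<alpha> 1 (u \<bullet> u) * (X \<bullet> Y) + \<beta> 1 (u \<bullet> u) * (X \<bullet> u) * (Y \<bullet> u)"
      using hl[OF X] hl[OF Y] u X Y by (simp_all add: ts Let_def canonical_metric_def)
  qed
  have hA: "h (fst A) \<in> ?T" "h (fst B) \<in> ?T" "vertical_lift (K A) \<in> ?T" "vertical_lift (K B) \<in> ?T"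
    using hT[OF A(1)] hT[OF B(1)] vT[OF K0[OF A(2)]] vT[OF K0[OF B(2)]] by auto
  have BT: "B \<in> ?T"
    using tangent_space_tangent_bundle_sphereI[OF x u B] by simp
  have split: "G (x, u) Z B = G (x, u) Z (h (fst B)) + G (x, u) Z (vertical_lift (K B))" if "Z \<in> ?T" for Z
    using add[OF hA(2,4) that] sym[OF that BT] sym[OF that hA(2)] sym[OF that hA(4)] dec[of B] by metis
  have "G (x, u) A B = G (x, u) (h (fst A)) B + G (x, u) (vertical_lift (K A)) B"
    using add[OF hA(1,3) BT] dec[of A] by metis
  also have "\<dots> = G (x, u) (h (fst A)) (h (fst B)) + G (x, u) (h (fst A)) (vertical_lift (K B))
     + (G (x, u) (vertical_lift (K A)) (h (fst B)) + G (x, u) (vertical_lift (K A)) (vertical_lift (K B)))"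
    using split hA by simp
  also have "\<dots> = natural_form \<alpha> \<beta> u A B"
  proof -
    have a: "snd A \<bullet> x = - (fst A \<bullet> u)" "snd B \<bullet> x = - (fst B \<bullet> u)" using A(2) B(2) by simp_all
    have e: "fst A \<bullet> K B = fst A \<bullet> snd B" "K A \<bullet> fst B = fst B \<bullet> snd A"
      "K A \<bullet> u = snd A \<bullet> u" "K B \<bullet> u = snd B \<bullet> u"
      using A(1) B(1) u by (simp_all add: K_def inner_simps inner_commute)
    have f: "K A \<bullet> K B = snd A \<bullet> snd B - (fst A \<bullet> u) * (fst B \<bullet> u)"
    proof -
      have "K A \<bullet> K B = snd A \<bullet> snd B + (fst B \<bullet> u) * (snd A \<bullet> x)
          + (fst A \<bullet> u) * (snd B \<bullet> x) + (fst A \<bullet> u) * (fst B \<bullet> u) * (x \<bullet> x)"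
        unfolding K_def inner_add_left inner_add_right inner_scaleR_left inner_scaleR_right
          inner_commute[of x "snd B"] by algebra
      then show ?thesis unfolding a xx by simp
    qed
    show ?thesis
      unfolding N(1)[OF A(1) B(1)] N(2)[OF A(1) K0[OF B(2)]] N(3)[OF K0[OF A(2)] B(1)]
        N(4)[OF K0[OF A(2)] K0[OF B(2)]] e f natural_form_def
      by algebra
  qed
  finally show ?thesis .
qed

section \<open>Derivative of the ambient form and the trace over the tangent space\<close>

text \<open>
  One-sided derivatives occur at the end point of the half line only.
\<close>

lemma smooth_halfline_has_derivative:
  assumes "smooth_halfline f" "t > 0"
  shows "(f has_real_derivative deriv f t) (at t)"
proof -
  obtain F where F: "\<And>t. t \<ge> 0 \<Longrightarrow> F 0 t = f t"
    "\<And>k t. t \<ge> 0 \<Longrightarrow> (F k has_real_derivative F (Suc k) t) (at t within {0..})"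
    using assms(1) unfolding smooth_halfline_def by blast
  have "at t within {0..} = at t" by (rule at_within_interior) (use assms(2) in simp)
  then have "(F 0 has_real_derivative F 1 t) (at t)" using F(2)[of t 0] assms(2) by simp
  then have "(f has_real_derivative F 1 t) (at t)"
    by (rule has_field_derivative_transform_within_open[where S="{0<..}"]) (use F(1) assms(2) in auto)
  then show ?thesis by (metis DERIV_imp_deriv)
qed

text \<open>
  The derivative of \<open>natural_form\<close> with respect to \<open>u\<close> in direction \<open>c\<close>. The first summand comes from the
  dependence of the coefficients on \<open>u \<bullet> u\<close>, the others from the factors \<open>_ \<bullet> u\<close>.
\<close>

definition natural_form_deriv :: "(nat \<Rightarrow> real \<Rightarrow> real) \<Rightarrow> (nat \<Rightarrow> real \<Rightarrow> real) \<Rightarrow>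
    'a::euclidean_space \<Rightarrow> 'a \<Rightarrow> 'a \<times> 'a \<Rightarrow> 'a \<times> 'a \<Rightarrow> real" where
  "natural_form_deriv \<alpha> \<beta> u c A B =
     2 * (u \<bullet> c) * (natural_form (\<lambda>i. deriv (\<alpha> i)) (\<lambda>i. deriv (\<beta> i)) u A B)
     + (\<beta> 1 (u \<bullet> u) + \<beta> 3 (u \<bullet> u) - \<alpha> 1 (u \<bullet> u)) * ((fst A \<bullet> c) * (fst B \<bullet> u) + (fst A \<bullet> u) * (fst B \<bullet> c))
     + \<beta> 2 (u \<bullet> u) * ((fst A \<bullet> c) * (snd B \<bullet> u) + (fst A \<bullet> u) * (snd B \<bullet> c)
         + (fst B \<bullet> c) * (snd A \<bullet> u) + (fst B \<bullet> u) * (snd A \<bullet> c))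
     + \<beta> 1 (u \<bullet> u) * ((snd A \<bullet> c) * (snd B \<bullet> u) + (snd A \<bullet> u) * (snd B \<bullet> c))"

lemma natural_form_has_derivative:
  assumes a: "\<And>i. i \<in> {1, 2, 3} \<Longrightarrow> (\<alpha> i has_real_derivative deriv (\<alpha> i) (u \<bullet> u)) (at (u \<bullet> u))"
    and b: "\<And>i. i \<in> {1, 2, 3} \<Longrightarrow> (\<beta> i has_real_derivative deriv (\<beta> i) (u \<bullet> u)) (at (u \<bullet> u))"
  shows "((\<lambda>u. natural_form \<alpha> \<beta> u A B) has_derivative (\<lambda>c. natural_form_deriv \<alpha> \<beta> u c A B)) (at u)"
proof -
  have sq: "((\<lambda>u. u \<bullet> u) has_derivative (\<lambda>c. 2 * (u \<bullet> c))) (at u)" for u :: 'a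
    by (auto intro!: derivative_eq_intros simp: inner_commute)
  have comp: "((\<lambda>u. f (u \<bullet> u)) has_derivative (\<lambda>c. deriv f (u \<bullet> u) * (2 * (u \<bullet> c)))) (at u)"
    if "(f has_real_derivative deriv f (u \<bullet> u)) (at (u \<bullet> u))" for f
    using has_derivative_compose[OF sq] that unfolding has_field_derivative_def by blast
  note d = comp[OF a[of 1]] comp[OF a[of 2]] comp[OF a[of 3]] comp[OF b[of 1]] comp[OF b[of 2]] comp[OF b[of 3]]
  show ?thesis
    unfolding natural_form_def
    by (rule has_derivative_eq_rhs, (rule derivative_intros d | simp)+)
       (simp add: natural_form_deriv_def natural_form_def fun_eq_iff algebra_simps)
qed

text \<open>
  Traces over the tangent space in terms of a basis of the model space and its dual basis. The second one is the
  inner product of the tangential parts of \<open>X\<close> and \<open>Y\<close>.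
\<close>

lemma trace_over_tangent_space:
  fixes \<phi> :: "'c::euclidean_space \<Rightarrow> 'a::euclidean_space"
  assumes dim: "DIM('a) = DIM('c) + 1" and \<phi>: "local_param (sphere 0 1) U \<phi>" and y: "y \<in> U"
  defines "S \<equiv> sharp (coord_metric canonical_metric \<phi> y)"
  shows "(\<Sum>e\<in>Basis. dd \<phi> y e \<bullet> dd \<phi> y (S e)) = DIM('c)"
    and "(\<Sum>e\<in>Basis. (dd \<phi> y e \<bullet> X) * (dd \<phi> y (S e) \<bullet> Y)) = X \<bullet> Y - (X \<bullet> \<phi> y) * (Y \<bullet> \<phi> y)"
proof -
  note P = local_paramD[OF \<phi>]
  have sub: "\<phi> ` U \<subseteq> sphere 0 1" using P(3) by blast
  have xx: "\<phi> y \<bullet> \<phi> y = 1" using sub y by (metis imageI mem_sphere_0 norm_eq_1 subset_eq)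
  have lin: "linear (dd \<phi> y)" using smooth_on_linear[OF P(2,1) y] .
  have tan: "dd \<phi> y v \<bullet> \<phi> y = 0" for v using sphere_param_tangent(1)[OF P(1,2) sub y] .
  have g: "coord_metric canonical_metric \<phi> y = (\<lambda>v w. dd \<phi> y v \<bullet> dd \<phi> y w)"
    by (simp add: fun_eq_iff coord_metric_def canonical_metric_def)
  have "linear (\<lambda>w. dd \<phi> y v \<bullet> dd \<phi> y w)" "linear (\<lambda>v. dd \<phi> y v \<bullet> dd \<phi> y w)" for v w
    by (rule linearI; simp add: linear_add[OF lin] linear_scale[OF lin] inner_simps)+
  then have bil: "bilinear (coord_metric canonical_metric \<phi> y)" unfolding g by (simp add: bilinear_def)
  have pos: "coord_metric canonical_metric \<phi> y u u > 0" if "u \<noteq> 0" for u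
  proof -
    have "dd \<phi> y u \<noteq> 0" using that P(4)[OF y] linear_injective_0[OF lin] by blast
    then show ?thesis by (simp add: g)
  qed
  have S: "dd \<phi> y (S e) \<bullet> dd \<phi> y w = e \<bullet> w" for e w
    using sharp_eq[OF bil pos, of e w] by (simp add: g S_def)
  have "dd \<phi> y e \<bullet> dd \<phi> y (S e) = 1" if "e \<in> Basis" for e
    using S[of e e] that by (simp add: inner_commute)
  then show "(\<Sum>e\<in>Basis. dd \<phi> y e \<bullet> dd \<phi> y (S e)) = DIM('c)" by simp
  have "(Y - (Y \<bullet> \<phi> y) *\<^sub>R \<phi> y) \<bullet> \<phi> y = 0" using xx by (simp add: inner_diff_left)
  then obtain w where w: "Y - (Y \<bullet> \<phi> y) *\<^sub>R \<phi> y = dd \<phi> y w"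
    using sphere_param_range[OF dim P(1,2) sub y P(4)[OF y]] by blast
  have Y: "Y = dd \<phi> y w + (Y \<bullet> \<phi> y) *\<^sub>R \<phi> y" using w by (metis diff_add_cancel)
  have "dd \<phi> y v \<bullet> Y = dd \<phi> y v \<bullet> dd \<phi> y w" for v
    by (subst Y) (simp add: inner_add_right tan)
  then have "(\<Sum>e\<in>Basis. (dd \<phi> y e \<bullet> X) * (dd \<phi> y (S e) \<bullet> Y)) = (\<Sum>e\<in>Basis. (w \<bullet> e) *\<^sub>R dd \<phi> y e) \<bullet> X"
    by (simp add: S inner_sum_left inner_commute[of w] mult.commute)
  also have "\<dots> = dd \<phi> y w \<bullet> X" using linear_basis_expansion[OF lin] by metis
  also have "\<dots> = X \<bullet> Y - (X \<bullet> \<phi> y) * (Y \<bullet> \<phi> y)"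
    unfolding w[symmetric] by (simp add: inner_diff_left inner_commute[of X] mult.commute)
  finally show "(\<Sum>e\<in>Basis. (dd \<phi> y e \<bullet> X) * (dd \<phi> y (S e) \<bullet> Y)) = X \<bullet> Y - (X \<bullet> \<phi> y) * (Y \<bullet> \<phi> y)" .
qed

section \<open>The tension field of a Hopf field\<close>

text \<open>
  Differentiate \<open>x \<bullet> x = 1\<close> and \<open>u \<bullet> x = 0\<close> along \<open>\<psi>\<close>.
\<close>

lemma tangent_bundle_param_tangent:
  fixes \<psi> :: "'d::euclidean_space \<Rightarrow> 'a::euclidean_space \<times> 'a"
  assumes \<psi>: "local_param (tangent_bundle (sphere 0 1)) W \<psi>" and q: "q \<in> W"
  shows "norm (fst (\<psi> q)) = 1" "snd (\<psi> q) \<bullet> fst (\<psi> q) = 0"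
    "fst (dd \<psi> q a) \<bullet> fst (\<psi> q) = 0"
    "snd (dd \<psi> q a) \<bullet> fst (\<psi> q) + fst (dd \<psi> q a) \<bullet> snd (\<psi> q) = 0"
proof -
  note P = local_paramD[OF \<psi>]
  have TS: "norm (fst (\<psi> z)) = 1 \<and> snd (\<psi> z) \<bullet> fst (\<psi> z) = 0" if "z \<in> W" for z
    using P(3)[OF that] by (auto simp: tangent_bundle_sphere)
  then show "norm (fst (\<psi> q)) = 1" "snd (\<psi> q) \<bullet> fst (\<psi> q) = 0" using q by auto
  have d: "(\<psi> has_derivative dd \<psi> q) (at q)" using smooth_on_has_derivative[OF P(1,2) q] .
  note f = has_derivative_fst[OF d] and s = has_derivative_snd[OF d]
  have 1: "fst (\<psi> z) \<bullet> fst (\<psi> z) = 1" if "z \<in> W" for z using TS[OF that] by (simp add: norm_eq_1)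
  have 2: "snd (\<psi> z) \<bullet> fst (\<psi> z) = 0" if "z \<in> W" for z using TS[OF that] by simp
  show "fst (dd \<psi> q a) \<bullet> fst (\<psi> q) = 0"
    using has_derivative_const_on_open[OF has_derivative_inner[OF f f] P(1) q 1, of a] by (simp add: inner_commute)
  show "snd (dd \<psi> q a) \<bullet> fst (\<psi> q) + fst (dd \<psi> q a) \<bullet> snd (\<psi> q) = 0"
    using has_derivative_const_on_open[OF has_derivative_inner[OF s f] P(1) q 2, of a] by (simp add: inner_commute)
qed

text \<open>
  The main computation: \<open>nabla_d_formula\<close> for the restriction \<open>r = f \<circ> \<phi>\<close> of the linear map \<open>x \<mapsto> (x, J x)\<close> and
  the ambient form \<open>natural_form\<close>, followed by the trace. The number \<open>J x \<bullet> k\<close>, with \<open>k\<close> the second component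
  of the test vector, enters because the derivative of \<open>u \<bullet> u\<close> in the direction of that vector is twice this
  number, whereas \<open>u \<bullet> u\<close> is constant along the section itself.
\<close>

lemma hopf_tension:
  fixes \<phi> :: "'c::euclidean_space \<Rightarrow> 'a::euclidean_space" and \<psi> :: "'c \<times> 'c \<Rightarrow> 'a \<times> 'a"
  assumes dim: "DIM('a) = DIM('c) + 1"
    and nat: "natural_metric TYPE('c) (sphere 0 1) canonical_metric \<alpha> \<beta> G"
    and riem: "riemannian_metric TYPE('c \<times> 'c) (tangent_bundle (sphere 0 1)) G"
    and a2: "\<alpha> 2 1 = 0" and b2: "\<beta> 2 1 = 0"
    and J: "linear J" "\<And>x. norm x = 1 \<Longrightarrow> \<xi> x = J x"
      "\<And>x y. J x \<bullet> y = - (x \<bullet> J y)" "\<And>x y. J x \<bullet> J y = x \<bullet> y"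
    and \<phi>: "local_param (sphere 0 1) U \<phi>" and \<psi>: "local_param (tangent_bundle (sphere 0 1)) W \<psi>"
    and y: "y \<in> U" and fy: "(\<phi> y, \<xi> (\<phi> y)) \<in> \<psi> ` W"
  defines "F \<equiv> \<lambda>z. inv_into W \<psi> (\<phi> z, \<xi> (\<phi> z))"
  shows "G (\<phi> y, \<xi> (\<phi> y)) (dd \<psi> (F y) (tension (coord_metric canonical_metric \<phi>) (coord_metric G \<psi>) F y)) (dd \<psi> (F y) c)
    = - (\<xi> (\<phi> y) \<bullet> snd (dd \<psi> (F y) c)) *
       ((real DIM('c) - 1) * (\<alpha> 1 1 + deriv (\<alpha> 1) 1) + DIM('c) * (deriv (\<alpha> 1) 1 + deriv (\<alpha> 3) 1)
        + (\<beta> 1 1 + \<beta> 3 1) + (deriv (\<beta> 1) 1 + deriv (\<beta> 3) 1))"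
proof -
  note P = local_paramD[OF \<phi>] and Q = local_paramD[OF \<psi>]
  note QT = tangent_bundle_param_tangent[OF \<psi>]
  have sub: "\<phi> ` U \<subseteq> sphere 0 1" using P(3) by blast
  have bJ: "bounded_linear J" using J(1) linear_conv_bounded_linear by blast
  have n1: "norm (\<phi> z) = 1" if "z \<in> U" for z using P(3)[OF that] by simp
  have Jx0: "J x \<bullet> x = 0" for x using J(3)[of x x] by (simp add: inner_commute)
  define r where "r z = (\<phi> z, J (\<phi> z))" for z
  have r\<xi>: "r z = (\<phi> z, \<xi> (\<phi> z))" if "z \<in> U" for z using J(2) n1[OF that] by (simp add: r_def)
  have rder: "(r has_derivative (\<lambda>v. (dd \<phi> z v, J (dd \<phi> z v)))) (at z)" if "z \<in> U" for z
    unfolding r_def using smooth_on_has_derivative[OF P(1,2) that]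
    by (intro has_derivative_Pair bounded_linear.has_derivative[OF bJ])
  have ddr: "dd r z v = (dd \<phi> z v, J (dd \<phi> z v))" if "z \<in> U" for z v using dd_eq[OF rder[OF that]] .
  have r2der: "((\<lambda>z. dd r z w) has_derivative (\<lambda>v. (dd (\<lambda>z. dd \<phi> z w) y v, J (dd (\<lambda>z. dd \<phi> z w) y v)))) (at y)" for w
  proof (rule has_derivative_transform_within_open[OF _ P(1) y ddr[symmetric]])
    show "((\<lambda>z. (dd \<phi> z w, J (dd \<phi> z w))) has_derivative
        (\<lambda>v. (dd (\<lambda>z. dd \<phi> z w) y v, J (dd (\<lambda>z. dd \<phi> z w) y v)))) (at y)"
      using smooth_on_has_derivative[OF P(1) smooth_on_dd[OF P(2)] y]
      by (intro has_derivative_Pair bounded_linear.has_derivative[OF bJ])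
  qed
  obtain N where N: "open N" "\<psi> ` W = tangent_bundle (sphere 0 1) \<inter> N" using Q(7) by (metis openin_open)
  \<comment> \<open>The part of the chart domain that the section maps into the image of \<open>\<psi>\<close>.\<close>
  define U' where "U' = {z \<in> U. r z \<in> N}"
  have rcont: "continuous_on U r"
    using rder by (metis P(1) continuous_on_eq_continuous_at has_derivative_continuous)
  have "U' = U \<inter> r -` N" by (auto simp: U'_def)
  then have U': "open U'" using continuous_open_preimage[OF rcont P(1) N(1)] by simp
  have rTS: "r z \<in> tangent_bundle (sphere 0 1)" if "z \<in> U" for z
    using n1[OF that] Jx0 by (simp add: r_def tangent_bundle_sphere)
  have r\<psi>: "r z \<in> \<psi> ` W" if "z \<in> U'" for z using that rTS N(2) by (auto simp: U'_def)
  have yU': "y \<in> U'" using y fy N(2) r\<xi>[OF y] by (auto simp: U'_def)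
  have F: "F z = inv_into W \<psi> (r z)" if "z \<in> U'" for z
    using that r\<xi> by (simp add: F_def U'_def)
  have FW: "F z \<in> W" if "z \<in> U'" for z using F[OF that] r\<psi>[OF that] by (simp add: inv_into_into)
  have \<psi>F: "\<psi> (F z) = r z" if "z \<in> U'" for z using F[OF that] r\<psi>[OF that] by (simp add: f_inv_into_f)
  have "continuous_on U' (\<lambda>z. inv_into W \<psi> (r z))"
    by (rule continuous_on_compose2[OF Q(6) continuous_on_subset[OF rcont]]) (use r\<psi> in \<open>auto simp: U'_def\<close>)
  then have Fcont: "continuous_on U' F" by (rule continuous_on_eq) (simp add: F)
  have r'd: "r differentiable at z" if "z \<in> U'" for z
    using rder that Derivative.differentiableI unfolding U'_def by blast
  have r''d: "(\<lambda>z. dd r z w) differentiable at y" for w using r2der Derivative.differentiableI by blast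
  define H where "H p = natural_form \<alpha> \<beta> (snd p)" for p :: "'a \<times> 'a"
  have bilH: "bilinear (H p)" and symH: "H p A B = H p B A" for p A B
    unfolding H_def by (rule natural_form_bilinear natural_form_sym)+
  have GH: "coord_metric G \<psi> q a b = H (\<psi> q) (dd \<psi> q a) (dd \<psi> q b)" if "q \<in> W" for q a b
    unfolding coord_metric_def H_def
    using natural_metric_eq_form[OF dim nat riem QT(1,2)[OF that] QT(3,4)[OF that] QT(3,4)[OF that]] by simp
  have pos: "coord_metric G \<psi> q a a > 0" if "q \<in> W" "a \<noteq> 0" for q a
  proof -
    have "linear (dd \<psi> q)" using smooth_on_linear[OF Q(2,1) that(1)] .
    then have "dd \<psi> q a \<noteq> 0" using that Q(4) linear_injective_0 by blast
    moreover have "dd \<psi> q a \<in> tangent_space (tangent_bundle (sphere 0 1)) (\<psi> q)"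
      using tangent_space_tangent_bundle_sphereI[OF QT[OF that(1)], of a] by simp
    ultimately show ?thesis
      unfolding coord_metric_def using riem Q(3)[OF that(1)] unfolding riemannian_metric_def by blast
  qed
  define x u where "x = \<phi> y" and "u = J x"
  have ry: "r y = (x, u)" by (simp add: r_def x_def u_def)
  have xx: "x \<bullet> x = 1" using n1[OF y] by (simp add: x_def norm_eq_1)
  have uu: "u \<bullet> u = 1" using J(4) xx by (simp add: u_def)
  have ux: "u \<bullet> x = 0" using Jx0 by (simp add: u_def)
  have smooth: "smooth_halfline (\<alpha> i)" "smooth_halfline (\<beta> i)" if "i \<in> {1, 2, 3}" for i
    using nat that unfolding natural_metric_def by blast+
  have DH: "((\<lambda>p. H p A B) has_derivative (\<lambda>C. natural_form_deriv \<alpha> \<beta> u (snd C) A B)) (at (r y))" for A B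
  proof -
    have "((\<lambda>v. natural_form \<alpha> \<beta> v A B) has_derivative (\<lambda>c. natural_form_deriv \<alpha> \<beta> u c A B)) (at u)"
      by (rule natural_form_has_derivative) (simp_all only: uu, (intro smooth_halfline_has_derivative smooth; simp)+)
    moreover have "(snd has_derivative snd) (at (r y))" by (auto intro!: derivative_eq_intros)
    ultimately show ?thesis unfolding H_def ry
      using has_derivative_compose[of snd snd "(x, u)" UNIV "\<lambda>v. natural_form \<alpha> \<beta> v A B"] by simp
  qed
  let ?g = "coord_metric canonical_metric \<phi>" and ?h = "coord_metric G \<psi>"
  define C where "C = dd \<psi> (F y) c"
  define Y k where "Y = fst C" and "k = snd C"
  define s where "s = u \<bullet> k"
  \<comment> \<open>\<open>\<kappa>\<close> is the coefficient of the second summand of the ambient form, \<open>A'\<close> and \<open>\<kappa>'\<close> are derivatives of its first two coefficients.\<close>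
  define \<kappa> where "\<kappa> = \<beta> 1 1 + \<beta> 3 1 - \<alpha> 1 1"
  define \<kappa>' where "\<kappa>' = deriv (\<beta> 1) 1 + deriv (\<beta> 3) 1 - deriv (\<alpha> 1) 1"
  define A' where "A' = deriv (\<alpha> 1) 1 + deriv (\<alpha> 3) 1"
  have Yx: "Y \<bullet> x = 0" and kx: "k \<bullet> x + Y \<bullet> u = 0"
    using QT(3,4)[OF FW[OF yU'], of c] \<psi>F[OF yU'] by (auto simp: Y_def k_def C_def ry)
  have nabla: "2 * H (r y) (dd \<psi> (F y) (nabla_d ?g ?h F y v w)) C =
      - 2 * (dd \<phi> y v \<bullet> dd \<phi> y w) * s * (\<alpha> 1 1 + A' + deriv (\<alpha> 1) 1)
      + \<kappa> * ((dd \<phi> y w \<bullet> u) * (Y \<bullet> J (dd \<phi> y v)) + (dd \<phi> y v \<bullet> u) * (Y \<bullet> J (dd \<phi> y w)))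
      - 2 * s * \<kappa>' * ((dd \<phi> y v \<bullet> u) * (dd \<phi> y w \<bullet> u))
      - \<kappa> * ((dd \<phi> y v \<bullet> k) * (dd \<phi> y w \<bullet> u) + (dd \<phi> y v \<bullet> u) * (dd \<phi> y w \<bullet> k))" for v w
  proof -
    define V X where "V = dd \<phi> y v" and "X = dd \<phi> y w"
    have Vx: "V \<bullet> x = 0" "X \<bullet> x = 0"
      unfolding V_def X_def x_def using sphere_param_tangent(1)[OF P(1,2) sub y] by auto
    have Ju: "J V \<bullet> u = 0" "J X \<bullet> u = 0" using J(4) Vx by (simp_all add: u_def)
    have inn: "u \<bullet> k = s" "k \<bullet> u = s" "x \<bullet> Y = 0" "x \<bullet> u = 0" "J V \<bullet> u = 0" "J X \<bullet> u = 0"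
      "u \<bullet> J V = 0" "u \<bullet> J X = 0" "X \<bullet> V = V \<bullet> X"
      using Yx ux Ju by (simp_all add: s_def inner_commute)
    have VX: "V \<bullet> J X = - (X \<bullet> J V)" using J(3)[of V X] by (simp add: inner_commute)
    have second: "dd (\<lambda>z. dd r z w) y v - dd r y (christoffel ?g y v w) = (- (V \<bullet> X) *\<^sub>R x, - (V \<bullet> X) *\<^sub>R u)"
    proof -
      let ?n = "dd (\<lambda>z. dd \<phi> z w) y v - dd \<phi> y (christoffel ?g y v w)"
      have "dd (\<lambda>z. dd r z w) y v - dd r y (christoffel ?g y v w) = (?n, J ?n)"
        using dd_eq[OF r2der] ddr[OF y] linear_diff[OF J(1)] by simp
      also have "?n = - (V \<bullet> X) *\<^sub>R x"
        unfolding V_def X_def x_def by (rule sphere_christoffel[OF dim \<phi> y])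
      also have "J (- (V \<bullet> X) *\<^sub>R x) = - (V \<bullet> X) *\<^sub>R u" unfolding u_def by (rule linear_scale[OF J(1)])
      finally show ?thesis .
    qed
    have "2 * H (r y) (dd \<psi> (F y) (nabla_d ?g ?h F y v w)) C =
       2 * H (r y) (dd (\<lambda>z. dd r z w) y v - dd r y (christoffel ?g y v w)) C
       + natural_form_deriv \<alpha> \<beta> u (snd (dd r y v)) (dd r y w) C
       + natural_form_deriv \<alpha> \<beta> u (snd (dd r y w)) (dd r y v) C
       - natural_form_deriv \<alpha> \<beta> u (snd C) (dd r y v) (dd r y w)"
      unfolding C_def
      by (rule nabla_d_formula[where H=H and h="coord_metric G \<psi>" and r=r and F=F and \<psi>=\<psi>
            and DH="\<lambda>C. natural_form_deriv \<alpha> \<beta> u (snd C)" and U=U',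
            OF Q(1,2,4) U' FW Fcont \<psi>F r'd yU' r''d GH bilH symH DH pos[OF FW[OF yU']]]; assumption)
    also have "\<dots> = 2 * natural_form \<alpha> \<beta> u (- (V \<bullet> X) *\<^sub>R x, - (V \<bullet> X) *\<^sub>R u) (Y, k)
       + natural_form_deriv \<alpha> \<beta> u (J V) (X, J X) (Y, k)
       + natural_form_deriv \<alpha> \<beta> u (J X) (V, J V) (Y, k)
       - natural_form_deriv \<alpha> \<beta> u k (V, J V) (X, J X)"
      unfolding second unfolding ddr[OF y] by (simp add: H_def ry V_def X_def Y_def k_def)
    also have "natural_form \<alpha> \<beta> u (- (V \<bullet> X) *\<^sub>R x, - (V \<bullet> X) *\<^sub>R u) (Y, k)
        = - (V \<bullet> X) * (\<alpha> 1 1 + \<beta> 1 1) * s"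
      unfolding natural_form_def fst_conv snd_conv inner_scaleR_left uu a2 b2 inn by algebra
    also have "natural_form_deriv \<alpha> \<beta> u (J V) (X, J X) (Y, k)
        = \<kappa> * ((X \<bullet> J V) * (Y \<bullet> u) + (X \<bullet> u) * (Y \<bullet> J V)) + \<beta> 1 1 * (V \<bullet> X) * s"
      unfolding natural_form_deriv_def fst_conv snd_conv uu b2 inn J(4) \<kappa>_def by algebra
    also have "natural_form_deriv \<alpha> \<beta> u (J X) (V, J V) (Y, k)
        = \<kappa> * ((V \<bullet> J X) * (Y \<bullet> u) + (V \<bullet> u) * (Y \<bullet> J X)) + \<beta> 1 1 * (V \<bullet> X) * s"
      unfolding natural_form_deriv_def fst_conv snd_conv uu b2 inn J(4) \<kappa>_def by algebra
    also have "natural_form_deriv \<alpha> \<beta> u k (V, J V) (X, J X)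
        = 2 * s * (A' * (V \<bullet> X) + \<kappa>' * ((V \<bullet> u) * (X \<bullet> u)) + deriv (\<alpha> 1) 1 * (V \<bullet> X))
          + \<kappa> * ((V \<bullet> k) * (X \<bullet> u) + (V \<bullet> u) * (X \<bullet> k))"
      unfolding natural_form_deriv_def natural_form_def fst_conv snd_conv uu b2 inn J(4) VX \<kappa>_def \<kappa>'_def A'_def
      by algebra
    finally show ?thesis unfolding V_def[symmetric] X_def[symmetric] VX by algebra
  qed
  let ?S = "sharp (?g y)"
  have lin\<psi>: "linear (dd \<psi> (F y))" using smooth_on_linear[OF Q(2,1) FW[OF yU']] .
  have linH: "linear (\<lambda>A. H (r y) A C)" using bilH[of "r y"] unfolding bilinear_def by blast
  note tr = trace_over_tangent_space[OF dim \<phi> y, folded x_def]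
  have tr': "(\<Sum>e\<in>Basis. (dd \<phi> y e \<bullet> X) * (dd \<phi> y (?S e) \<bullet> u)) = X \<bullet> u"
    "(\<Sum>e\<in>Basis. (dd \<phi> y e \<bullet> u) * (dd \<phi> y (?S e) \<bullet> X)) = X \<bullet> u" for X
    unfolding tr(2) ux inner_commute[of u X] by simp_all
  \<comment> \<open>Moving \<open>J\<close> to \<open>Y\<close> turns the terms with \<open>J\<close> into traces that vanish because \<open>J Y\<close> is orthogonal to \<open>u = J x\<close>.\<close>
  have JY: "Y \<bullet> J Z = - (Z \<bullet> J Y)" for Z using J(3)[of Y Z] unfolding inner_commute[of "J Y"] by linarith
  have JYu: "J Y \<bullet> u = 0" using J(4) Yx by (simp add: u_def)
  have "2 * H (r y) (dd \<psi> (F y) (tension ?g ?h F y)) C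
     = (\<Sum>e\<in>Basis. 2 * H (r y) (dd \<psi> (F y) (nabla_d ?g ?h F y e (?S e))) C)"
    unfolding tension_def metric_trace_def linear_sum[OF lin\<psi>] linear_sum[OF linH] sum_distrib_left ..
  also have "\<dots> = - 2 * (\<Sum>e\<in>Basis. dd \<phi> y e \<bullet> dd \<phi> y (?S e)) * s * (\<alpha> 1 1 + A' + deriv (\<alpha> 1) 1)
      - \<kappa> * ((\<Sum>e\<in>Basis. (dd \<phi> y e \<bullet> J Y) * (dd \<phi> y (?S e) \<bullet> u)) + (\<Sum>e\<in>Basis. (dd \<phi> y e \<bullet> u) * (dd \<phi> y (?S e) \<bullet> J Y)))
      - 2 * s * \<kappa>' * (\<Sum>e\<in>Basis. (dd \<phi> y e \<bullet> u) * (dd \<phi> y (?S e) \<bullet> u))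
      - \<kappa> * ((\<Sum>e\<in>Basis. (dd \<phi> y e \<bullet> k) * (dd \<phi> y (?S e) \<bullet> u)) + (\<Sum>e\<in>Basis. (dd \<phi> y e \<bullet> u) * (dd \<phi> y (?S e) \<bullet> k)))"
    unfolding nabla JY sum_distrib_left sum_distrib_right sum.distrib[symmetric] sum_subtractf[symmetric]
    by (rule sum.cong[OF refl]) algebra
  also have "\<dots> = - 2 * real DIM('c) * s * (\<alpha> 1 1 + A' + deriv (\<alpha> 1) 1) - 2 * s * \<kappa>' - 2 * \<kappa> * s"
    unfolding tr(1) tr' JYu uu inner_commute[of k] s_def[symmetric] by algebra
  finally have "H (r y) (dd \<psi> (F y) (tension ?g ?h F y)) C
     = - s * (real DIM('c) * (\<alpha> 1 1 + A' + deriv (\<alpha> 1) 1) + \<kappa>' + \<kappa>)" by (simp add: algebra_simps)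
  moreover have "H (r y) (dd \<psi> (F y) a) C = G (\<phi> y, \<xi> (\<phi> y)) (dd \<psi> (F y) a) (dd \<psi> (F y) c)" for a
    using GH[OF FW[OF yU'], of a c] \<psi>F[OF yU'] r\<xi>[OF y] by (simp add: coord_metric_def C_def)
  moreover have "s = \<xi> (\<phi> y) \<bullet> snd (dd \<psi> (F y) c)"
    using r\<xi>[OF y] ry by (simp add: s_def k_def C_def)
  ultimately have "G (\<phi> y, \<xi> (\<phi> y)) (dd \<psi> (F y) (tension ?g ?h F y)) (dd \<psi> (F y) c)
      = - (\<xi> (\<phi> y) \<bullet> snd (dd \<psi> (F y) c)) * (real DIM('c) * (\<alpha> 1 1 + A' + deriv (\<alpha> 1) 1) + \<kappa>' + \<kappa>)"
    by simp
  also have "real DIM('c) * (\<alpha> 1 1 + A' + deriv (\<alpha> 1) 1) + \<kappa>' + \<kappa>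
     = (real DIM('c) - 1) * (\<alpha> 1 1 + deriv (\<alpha> 1) 1) + real DIM('c) * (deriv (\<alpha> 1) 1 + deriv (\<alpha> 3) 1)
        + (\<beta> 1 1 + \<beta> 3 1) + (deriv (\<beta> 1) 1 + deriv (\<beta> 3) 1)"
    unfolding A'_def \<kappa>_def \<kappa>'_def by algebra
  finally show ?thesis .
qed

theorem corollary5:
  fixes m :: nat
    and \<xi> :: "'a::euclidean_space \<Rightarrow> 'a"
    and \<alpha> \<beta> :: "nat \<Rightarrow> real \<Rightarrow> real"
    and G :: "'a \<times> 'a \<Rightarrow> 'a \<times> 'a \<Rightarrow> 'a \<times> 'a \<Rightarrow> real"
  assumes "DIM('a) = 2 * m + 2"
    and "DIM('c::euclidean_space) = 2 * m + 1"
    and "natural_metric TYPE('c) (sphere 0 1) canonical_metric \<alpha> \<beta> G"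
    and "riemannian_metric TYPE('c \<times> 'c) (tangent_bundle (sphere 0 1)) G"
    and "\<alpha> 2 1 = 0" and "\<beta> 2 1 = 0"
    and "hopf_field TYPE('c) \<xi>"
  shows "harmonic_map TYPE('c) TYPE('c \<times> 'c)
           (sphere 0 1) canonical_metric (tangent_bundle (sphere 0 1)) G (\<lambda>x. (x, \<xi> x)) \<longleftrightarrow>
         2 * real m * (\<alpha> 1 1 + deriv (\<alpha> 1) 1) +
         deriv (\<lambda>t. 2 * real m * (\<alpha> 1 t + \<alpha> 3 t) + phi \<alpha> \<beta> 1 t + phi \<alpha> \<beta> 3 t) 1 = 0"
proof -
  let ?harmonic = "harmonic_map TYPE('c) TYPE('c \<times> 'c)
    (sphere 0 1) canonical_metric (tangent_bundle (sphere 0 1)) G (\<lambda>x. (x, \<xi> x))"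
  let ?E = "2 * real m * (\<alpha> 1 1 + deriv (\<alpha> 1) 1) +
    deriv (\<lambda>t. 2 * real m * (\<alpha> 1 t + \<alpha> 3 t) + phi \<alpha> \<beta> 1 t + phi \<alpha> \<beta> 3 t) 1"
  let ?S = "sphere 0 1 :: 'a set" and ?TS = "tangent_bundle (sphere 0 1) :: ('a \<times> 'a) set"
  have dim: "DIM('a) = DIM('c) + 1" using assms(1,2) by simp
  obtain J where J: "linear J" "\<And>x. norm x = 1 \<Longrightarrow> \<xi> x = J x"
    "\<And>x y. J x \<bullet> y = - (x \<bullet> J y)" "\<And>x y. J x \<bullet> J y = x \<bullet> y"
    by (rule hopf_field_linear[OF dim assms(7)]) (rule that; assumption)
  have smooth: "smooth_halfline (\<alpha> i)" "smooth_halfline (\<beta> i)" if "i \<in> {1, 2, 3}" for i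
    using assms(3) that unfolding natural_metric_def by blast+
  note D = smooth(1)[THEN smooth_halfline_has_derivative, OF _ zero_less_one]
    smooth(2)[THEN smooth_halfline_has_derivative, OF _ zero_less_one]
  have "((\<lambda>t. 2 * real m * (\<alpha> 1 t + \<alpha> 3 t) + phi \<alpha> \<beta> 1 t + phi \<alpha> \<beta> 3 t) has_real_derivative
      (2 * real m * (deriv (\<alpha> 1) 1 + deriv (\<alpha> 3) 1) + (deriv (\<alpha> 1) 1 + (\<beta> 1 1 + deriv (\<beta> 1) 1))
       + (deriv (\<alpha> 3) 1 + (\<beta> 3 1 + deriv (\<beta> 3) 1)))) (at 1)"
    unfolding phi_def
    by (rule derivative_eq_intros D | simp)+
  then have E: "?E = (real DIM('c) - 1) * (\<alpha> 1 1 + deriv (\<alpha> 1) 1) + DIM('c) * (deriv (\<alpha> 1) 1 + deriv (\<alpha> 3) 1)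
        + (\<beta> 1 1 + \<beta> 3 1) + (deriv (\<beta> 1) 1 + deriv (\<beta> 3) 1)"
    unfolding DERIV_imp_deriv[OF \<open>(_ has_real_derivative _) _\<close>] by (simp add: assms(2) algebra_simps)
  have T: "G (\<phi> y, \<xi> (\<phi> y))
      (dd \<psi> (inv_into W \<psi> (\<phi> y, \<xi> (\<phi> y)))
        (tension (coord_metric canonical_metric \<phi>) (coord_metric G \<psi>)
          (\<lambda>z. inv_into W \<psi> (\<phi> z, \<xi> (\<phi> z))) y))
      (dd \<psi> (inv_into W \<psi> (\<phi> y, \<xi> (\<phi> y))) c)
    = - (\<xi> (\<phi> y) \<bullet> snd (dd \<psi> (inv_into W \<psi> (\<phi> y, \<xi> (\<phi> y))) c)) * ?E"
    if "local_param ?S U \<phi>" "local_param ?TS W \<psi>" "y \<in> U" "(\<phi> y, \<xi> (\<phi> y)) \<in> \<psi> ` W"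
    for \<phi> :: "'c \<Rightarrow> 'a" and \<psi> :: "'c \<times> 'c \<Rightarrow> 'a \<times> 'a" and U W y c
    unfolding E by (rule hopf_tension[where \<xi>=\<xi> and J=J, OF dim assms(3-6) J(1) _ J(3,4) that]) (rule J(2))
  have vf: "vector_field TYPE('c) ?S \<xi>" using assms(7) by (simp add: hopf_field_def killing_field_def)
  have maps: "(\<lambda>x. (x, \<xi> x)) ` ?S \<subseteq> ?TS"
    using vf by (auto simp: vector_field_def tangent_bundle_def)
  have smooth_section: "smooth_map TYPE('c) ?S (\<lambda>x. (x, \<xi> x))"
    unfolding smooth_map_def
  proof (intro allI impI)
    fix U :: "'c set" and \<phi> assume \<phi>: "local_param ?S U \<phi>"
    then have "smooth_on U (\<lambda>y. \<xi> (\<phi> y))" using vf unfolding vector_field_def smooth_map_def by blast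
    then show "smooth_on U (\<lambda>y. (\<phi> y, \<xi> (\<phi> y)))" using smooth_on_Pair local_paramD(1,2)[OF \<phi>] by blast
  qed
  show ?thesis
  proof
    assume harm: ?harmonic
    obtain x :: 'a where x: "norm x = 1" using vector_choose_size[of 1] by auto
    obtain \<phi> :: "'c \<Rightarrow> 'a" and p N where c: "smooth_on UNIV \<phi>" "open N" "smooth_on N p"
      "range \<phi> = sphere 0 1 \<inter> N" "\<And>y. p (\<phi> y) = y" "x \<in> N"
      by (rule sphere_chart[OF dim x]) (rule that; assumption)
    note L = tangent_param_local_param[OF dim c(1-5)]
    define y :: 'c where "y = 0"
    have yS: "\<phi> y \<in> ?S" using c(4) by blast
    have "\<xi> (\<phi> y) \<bullet> \<phi> y = 0"
      using maps yS tangent_bundle_sphere by blast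
    then obtain v where v: "\<xi> (\<phi> y) = dd \<phi> y v"
      using sphere_param_range[OF dim open_UNIV c(1) _ UNIV_I local_paramD(4)[OF L(1) UNIV_I], of y] c(4) by blast
    define q where "q = (y, v)"
    have q: "tangent_param \<phi> q = (\<phi> y, \<xi> (\<phi> y))" by (simp add: q_def tangent_param_def v)
    then have im: "(\<phi> y, \<xi> (\<phi> y)) \<in> range (tangent_param \<phi>)" by (metis rangeI)
    have Fy: "inv_into UNIV (tangent_param \<phi>) (\<phi> y, \<xi> (\<phi> y)) = q"
      using inv_into_f_f[OF local_paramD(5)[OF L(2)], of q] q by simp
    \<comment> \<open>The test vector: the vertical lift of \<open>\<xi>\<close> itself.\<close>
    have vert: "dd (tangent_param \<phi>) q (0, v) = (0, \<xi> (\<phi> y))"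
      unfolding q_def dd_tangent_param[OF open_UNIV c(1) UNIV_I]
      using linear_0[OF smooth_on_linear[OF c(1) open_UNIV UNIV_I]]
        linear_0[OF linear_frechet_derivative[OF smooth_on_differentiable[OF open_UNIV smooth_on_dd[OF c(1)] UNIV_I]]]
      by (simp add: v)
    have "norm (\<phi> y) = 1" using yS by simp
    then have uu: "\<xi> (\<phi> y) \<bullet> \<xi> (\<phi> y) = 1" using J(2,4) by (simp add: norm_eq_1)
    let ?\<tau> = "tension (coord_metric canonical_metric \<phi>) (coord_metric G (tangent_param \<phi>))
        (\<lambda>z. inv_into UNIV (tangent_param \<phi>) (\<phi> z, \<xi> (\<phi> z))) y"
    \<comment> \<open>A single point of a single chart is enough for this direction.\<close>
    have "?\<tau> = 0" using harm L im unfolding harmonic_map_def by blast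
    moreover have "linear (dd (tangent_param \<phi>) q)"
      using smooth_on_linear[OF local_paramD(2,1)[OF L(2)]] by blast
    ultimately have "G (\<phi> y, \<xi> (\<phi> y)) 0 (0, \<xi> (\<phi> y)) = - ?E"
      using T[OF L UNIV_I im, of "(0, v)"] by (simp only: Fy vert linear_0) (simp add: uu)
    moreover have "G (\<phi> y, \<xi> (\<phi> y)) 0 (0, \<xi> (\<phi> y)) = 0"
    proof -
      have "(\<phi> y, \<xi> (\<phi> y)) \<in> ?TS" using maps yS by blast
      moreover have "(0, \<xi> (\<phi> y)) \<in> tangent_space ?TS (\<phi> y, \<xi> (\<phi> y))"
        using \<open>norm (\<phi> y) = 1\<close> \<open>\<xi> (\<phi> y) \<bullet> \<phi> y = 0\<close> by (intro tangent_space_tangent_bundle_sphereI) auto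
      ultimately have "G (\<phi> y, \<xi> (\<phi> y)) (0 *\<^sub>R (0, \<xi> (\<phi> y)) + 0 *\<^sub>R (0, \<xi> (\<phi> y))) (0, \<xi> (\<phi> y)) = 
         0 * G (\<phi> y, \<xi> (\<phi> y)) (0, \<xi> (\<phi> y)) (0, \<xi> (\<phi> y)) + 0 * G (\<phi> y, \<xi> (\<phi> y)) (0, \<xi> (\<phi> y)) (0, \<xi> (\<phi> y))"
        using assms(4) unfolding riemannian_metric_def by blast
      then show ?thesis by (simp add: zero_prod_def)
    qed
    ultimately show "?E = 0" by simp
  next
    assume E0: "?E = 0"
    show ?harmonic
      unfolding harmonic_map_def
    proof (intro conjI allI impI ballI maps smooth_section)
      fix U :: "'c set" and \<phi> and W :: "('c \<times> 'c) set" and \<psi> and y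
      assume \<phi>: "local_param ?S U \<phi>" and \<psi>: "local_param ?TS W \<psi>"
        and y: "y \<in> U" and im: "(\<phi> y, \<xi> (\<phi> y)) \<in> \<psi> ` W"
      let ?q = "inv_into W \<psi> (\<phi> y, \<xi> (\<phi> y))"
      let ?\<tau> = "tension (coord_metric canonical_metric \<phi>) (coord_metric G \<psi>)
        (\<lambda>z. inv_into W \<psi> (\<phi> z, \<xi> (\<phi> z))) y"
      have q: "?q \<in> W" "\<psi> ?q = (\<phi> y, \<xi> (\<phi> y))" using im by (auto simp: inv_into_into f_inv_into_f)
      note Q = local_paramD[OF \<psi>]
      have lin: "linear (dd \<psi> ?q)" by (rule smooth_on_linear[OF Q(2,1) q(1)])
      have null: "G (\<psi> ?q) (dd \<psi> ?q ?\<tau>) (dd \<psi> ?q ?\<tau>) = 0"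
        using T[OF \<phi> \<psi> y im, of ?\<tau>] unfolding E0 q(2) by simp
      have tan: "dd \<psi> ?q ?\<tau> \<in> tangent_space ?TS (\<psi> ?q)"
        using tangent_space_tangent_bundle_sphereI[OF tangent_bundle_param_tangent[OF \<psi> q(1)], of ?\<tau>] by simp
      have pos: "\<forall>z\<in>?TS. \<forall>X\<in>tangent_space ?TS z. X \<noteq> 0 \<longrightarrow> G z X X > 0"
        using assms(4) unfolding riemannian_metric_def by blast
      have "dd \<psi> ?q ?\<tau> = 0"
        using pos[rule_format, OF Q(3)[OF q(1)] tan] unfolding null by blast
      then show "?\<tau> = 0"
        using injD[OF Q(4)[OF q(1)], of ?\<tau> 0] unfolding linear_0[OF lin] by blast
    qed
  qed
qed

end
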